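(* The orbit of an $n\times n$ CMV matrix under the dressing transformations $$\beta\mapsto \lambda\beta\,(\beta^{-1}\lambda^{-1}\omega^{-1}\beta)_+=\omega^{-1}\beta\,(\beta^{-1}\lambda^{-1}\omega^{-1}\beta)_-,\qquad \lambda\in\mathbb{L}(n),\ \omega\in\mathbb{U}(n),$$ is precisely the set of $n\times n$ CMV matrices with the same determinant.
   Context: $\mathbb{U}(n)$ is the group of $n\times n$ unitary matrices and $\mathbb{L}(n)$ the group of $n\times n$ (complex) lower triangular matrices with positive diagonal entries. Each $\beta\in GL(n,\mathbb{C})$ has a unique factorization $\beta=\beta_+\beta_-^{-1}$ with $\beta_+\in\mathbb{L}(n)$ and $\beta_-\in\mathbb{U}(n)$; this defines $(\cdot)_+$ and $(\cdot)_-$. The dressing transformations define an action on $GL(n,\mathbb{C})$ of the group $\mathbb{L}(n)\times\mathbb{U}^{r}(n)$, where $\mathbb{U}^r(n)$ is $\mathbb{U}(n)$ with the order of multiplication reversed. CMV matrices: given $\alpha_0,\ldots,\alpha_{n-2}$ in the open unit disk $\mathbb{D}$ and $\alpha_{n-1}$ on the unit circle, put $\rho_k=\sqrt{1-|\alpha_k|^2}$, $\Xi_k=\begin{bmatrix}\bar\alpha_k&\rho_k\\ \rho_k&-\alpha_k\end{bmatrix}$ for $0\le k\le n-2$, and $1\times1$ matrices $\Xi_{-1}=[1]$, $\Xi_{n-1}=[\bar\alpha_{n-1}]$. The $n\times n$ CMV matrix with these coefficients is $\mathcal{C}=\mathcal{L}\mathcal{M}$, where $\mathcal{L}=\mathrm{diag}(\Xi_0,\Xi_2,\Xi_4,\ldots)$,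 $\mathcal{M}=\mathrm{diag}(\Xi_{-1},\Xi_1,\Xi_3,\ldots)$ are $n\times n$ block-diagonal. *)

theory Defs
  imports "Jordan_Normal_Form.Schur_Decomposition" "HOL-Algebra.Group_Action"
begin

definition GL :: "nat \<Rightarrow> complex mat monoid" where
  "GL n = units_of (ring_mat TYPE(complex) n ())"

definition unitary_group :: "nat \<Rightarrow> complex mat monoid" where
  "unitary_group n = (GL n)
     \<lparr>carrier := {U \<in> carrier_mat n n. mat_adjoint U * U = 1\<^sub>m n \<and> U * mat_adjoint U = 1\<^sub>m n}\<rparr>"

definition lower_group :: "nat \<Rightarrow> complex mat monoid" where
  "lower_group n = (GL n)
     \<lparr>carrier := {L \<in> carrier_mat n n.
        (\<forall>i<n. \<forall>j<n. i < j \<longrightarrow> L $$ (i, j) = 0) \<and>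
        (\<forall>i<n. Im (L $$ (i, i)) = 0 \<and> 0 < Re (L $$ (i, i)))}\<rparr>"

definition reversed :: "'a monoid \<Rightarrow> 'a monoid" where
  "reversed G = G\<lparr>mult := \<lambda>x y. y \<otimes>\<^bsub>G\<^esub> x\<rparr>"

text \<open>The factors of the unique factorization of an invertible matrix as
  (lower triangular with positive diagonal) times (unitary) inverse. They are
  meaningful only for members of \<open>carrier (GL n)\<close>.\<close>

definition plus_part :: "nat \<Rightarrow> complex mat \<Rightarrow> complex mat" where
  "plus_part n b = (THE p. p \<in> carrier (lower_group n) \<and>
     (\<exists>m \<in> carrier (unitary_group n). b = p * inv\<^bsub>GL n\<^esub> m))"

definition minus_part :: "nat \<Rightarrow> complex mat \<Rightarrow> complex mat" where
  "minus_part n b = (THE m. m \<in> carrier (unitary_group n) \<and>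
     (\<exists>p \<in> carrier (lower_group n). b = p * inv\<^bsub>GL n\<^esub> m))"

definition dressing_arg :: "nat \<Rightarrow> complex mat \<Rightarrow> complex mat \<Rightarrow> complex mat \<Rightarrow> complex mat" where
  "dressing_arg n l w b = inv\<^bsub>GL n\<^esub> b * inv\<^bsub>GL n\<^esub> l * inv\<^bsub>GL n\<^esub> w * b"

text \<open>\<open>l\<close> and \<open>w\<close> play the roles of \<open>\<lambda>\<close> and \<open>\<omega>\<close>.\<close>

definition dressing :: "nat \<Rightarrow> complex mat \<times> complex mat \<Rightarrow> complex mat \<Rightarrow> complex mat" where
  "dressing n = (\<lambda>(l, w) b. l * b * plus_part n (dressing_arg n l w b))"

definition dressing_group :: "nat \<Rightarrow> (complex mat \<times> complex mat) monoid" where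
  "dressing_group n = lower_group n \<times>\<times> reversed (unitary_group n)"

definition cmv_rho :: "(nat \<Rightarrow> complex) \<Rightarrow> nat \<Rightarrow> real" where
  "cmv_rho a k = sqrt (1 - (cmod (a k))\<^sup>2)"

definition cmv_Xi :: "nat \<Rightarrow> (nat \<Rightarrow> complex) \<Rightarrow> nat \<Rightarrow> complex mat" where
  "cmv_Xi n a k =
     (if Suc k < n
      then mat_of_rows_list 2 [[cnj (a k), of_real (cmv_rho a k)],
                               [of_real (cmv_rho a k), - a k]]
      else mat_of_rows_list 1 [[cnj (a k)]])"

definition cmv_L :: "nat \<Rightarrow> (nat \<Rightarrow> complex) \<Rightarrow> complex mat" where
  "cmv_L n a = diag_block_mat (map (cmv_Xi n a) (filter even [0..<n]))"

text \<open>The leading \<open>1\<^sub>m 1\<close> is the block with index \<open>-1\<close>.\<close>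

definition cmv_M :: "nat \<Rightarrow> (nat \<Rightarrow> complex) \<Rightarrow> complex mat" where
  "cmv_M n a = diag_block_mat (1\<^sub>m 1 # map (cmv_Xi n a) (filter odd [0..<n]))"

definition cmv_matrix :: "nat \<Rightarrow> (nat \<Rightarrow> complex) \<Rightarrow> complex mat" where
  "cmv_matrix n a = cmv_L n a * cmv_M n a"

text \<open>Only the values \<open>a 0, \<dots>, a (n - 1)\<close> matter; \<open>n\<close> is meant to be positive.\<close>

definition cmv_matrices :: "nat \<Rightarrow> complex mat set" where
  "cmv_matrices n = {cmv_matrix n a | a.
     (\<forall>k. Suc k < n \<longrightarrow> cmod (a k) < 1) \<and> cmod (a (n - 1)) = 1}"

end

theory Submission
  imports Defs
begin

text \<open>
  Write \<open>A \<sim> B\<close> if \<open>B = l A p\<close> with \<open>l, p \<in> L(n)\<close>. Uniqueness of the factorization shows that the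
  dressing orbit of a unitary \<open>C\<close> consists of the unitary \<open>D\<close> with \<open>C \<sim> D\<close>: such a \<open>D\<close> is reached from
  \<open>C\<close> with \<open>\<omega> = C D\<^sup>*\<close>, for which the unitary factor is trivial.

  CMV matrices satisfy the recursion
  \<open>C(\<alpha>\<^sub>0, \<alpha>\<^sub>1, \<dots>) = (\<Xi>\<^sub>0 \<oplus> 1) (1 \<oplus> C(\<alpha>\<^sub>1, \<dots>)\<^sup>T)\<close>. The block \<open>\<Xi>\<^sub>0\<close> is \<open>\<sim>\<close>-equivalent to the swap of two
  coordinates, and the triangular factors can be moved past \<open>1 \<oplus> X\<close>, so
  \<open>(\<Xi>(z) \<oplus> 1) (1 \<oplus> X) \<sim> (\<Xi>(w) \<oplus> 1) (1 \<oplus> Y)\<close> holds for all \<open>z\<close> and \<open>w\<close> in the disk precisely when \<open>X \<sim> Y\<close>.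
  Moreover \<open>\<sim>\<close> preserves the shape of the first column, so a unitary matrix equivalent to
  \<open>(\<Xi>(z) \<oplus> 1) (1 \<oplus> X)\<close> is again of this form. Both inclusions follow by induction on \<open>n\<close>.
\<close>

section \<open>Lower triangular and unitary factors\<close>

lemma index_mult_mat_sum:
  assumes "A \<in> carrier_mat n m" "B \<in> carrier_mat m k" "i < n" "j < k"
  shows "(A * B) $$ (i, j) = (\<Sum>t<m. A $$ (i, t) * B $$ (t, j))"
  using assms by (auto simp: scalar_prod_def lessThan_atLeast0 intro!: sum.cong)

lemma dim_mat_adjoint [simp]: "dim_row (mat_adjoint A) = dim_col A" "dim_col (mat_adjoint A) = dim_row A"
  by (simp_all add: mat_adjoint_def)

lemma mat_adjoint_carrier [simp]: "A \<in> carrier_mat n m \<Longrightarrow> mat_adjoint A \<in> carrier_mat m n"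
  by auto

lemma index_mat_adjoint:
  assumes "A \<in> carrier_mat n n" "i < n" "j < n"
  shows "mat_adjoint A $$ (i, j) = conjugate (A $$ (j, i))"
  using assms by (auto simp: mat_adjoint_def mat_of_rows_index)

lemma mat_adjoint_mult:
  fixes A B :: "complex mat"
  assumes "A \<in> carrier_mat n n" "B \<in> carrier_mat n n"
  shows "mat_adjoint (A * B) = mat_adjoint B * mat_adjoint A"
proof (rule eq_matI)
  fix i j assume "i < dim_row (mat_adjoint B * mat_adjoint A)" "j < dim_col (mat_adjoint B * mat_adjoint A)"
  then have ij: "i < n" "j < n"
    using assms by simp_all
  have AB: "A * B \<in> carrier_mat n n" using assms by simp
  have "mat_adjoint (A * B) $$ (i, j) = (\<Sum>t<n. cnj (B $$ (t, i)) * cnj (A $$ (j, t)))"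
    using index_mat_adjoint[OF AB ij] index_mult_mat_sum[OF assms ij(2,1)] 
    by (simp add: mult.commute del: index_mult_mat(1))
  also have "\<dots> = (\<Sum>t<n. mat_adjoint B $$ (i, t) * mat_adjoint A $$ (t, j))"
    using ij assms by (intro sum.cong refl) (simp add: index_mat_adjoint[of _ n])
  also have "\<dots> = (mat_adjoint B * mat_adjoint A) $$ (i, j)"
    using index_mult_mat_sum[OF mat_adjoint_carrier[OF assms(2)] mat_adjoint_carrier[OF assms(1)] ij] by simp
  finally show "mat_adjoint (A * B) $$ (i, j) = (mat_adjoint B * mat_adjoint A) $$ (i, j)" .
qed simp_all

lemma mat_adjoint_adjoint:
  "A \<in> carrier_mat n n \<Longrightarrow> mat_adjoint (mat_adjoint A) = (A :: complex mat)"
  by (rule eq_matI) (simp_all add: index_mat_adjoint[of "mat_adjoint A" n] index_mat_adjoint[of A n])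

section \<open>The general linear group\<close>

lemma GL_group: "group (GL n)"
proof -
  interpret ring "ring_mat TYPE(complex) n ()" by (rule ring_mat)
  show ?thesis unfolding GL_def by (rule units_group)
qed

lemma mult_GL: "monoid.mult (GL n) = (*)" and one_GL: "monoid.one (GL n) = 1\<^sub>m n"
  by (simp_all add: GL_def units_of_mult units_of_one ring_mat_simps)

text \<open>The rewrite rules turn the group laws into statements about \<open>*\<close> and
  \<open>1\<^sub>m n\<close>, the form in which they apply to matrix terms. The interpretation stays
  local to the context; only the selected facts leave it.\<close>

context
  fixes n :: nat
begin

interpretation GL: group "GL n"
  rewrites "monoid.mult (GL n) = (*)" and "monoid.one (GL n) = 1\<^sub>m n"
  by (simp_all add: GL_group mult_GL one_GL)

lemmas GL_assoc = GL.m_assoc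
  and GL_inv_equality = GL.inv_equality
  and GL_inv_mult = GL.inv_mult_group

text \<open>Later proofs cite these facts by position: 5 and 6 are the left and right inverse laws,
  8 is the right unit law.\<close>

lemmas GL_simps [simp] = GL.m_closed GL.inv_closed GL.one_closed GL.inv_inv
  GL.l_inv GL.r_inv GL.l_one GL.r_one

end

lemma carrier_GL: "A \<in> carrier (GL n) \<longleftrightarrow> A \<in> carrier_mat n n \<and> det A \<noteq> 0"
proof -
  have "A \<in> Units (ring_mat TYPE(complex) n ()) \<Longrightarrow> A \<in> carrier_mat n n"
    by (auto simp: Units_def ring_mat_simps)
  then show ?thesis
    using unit_imp_det_non_zero[of A n "()"] det_non_zero_imp_unit[of A n "()"]
    by (auto simp: GL_def units_of_carrier)
qed

text \<open>The determinants of \<open>A\<close> and \<open>B\<close> are nonzero because their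
  product is 1, and a right inverse of a square matrix is also a left inverse.\<close>

lemma right_inverse_GL:
  assumes "A \<in> carrier_mat n n" "B \<in> carrier_mat n n" "A * B = 1\<^sub>m n"
  shows "A \<in> carrier (GL n)" "inv\<^bsub>GL n\<^esub> A = B"
proof -
  have "det A * det B = 1" using assms det_mult[of A n B] by simp
  then have A: "A \<in> carrier (GL n)" and B: "B \<in> carrier (GL n)"
    using assms(1,2) by (auto simp: carrier_GL)
  show "A \<in> carrier (GL n)" by (fact A)
  have "B * A = 1\<^sub>m n" using assms by (rule mat_mult_left_right_inverse)
  then show "inv\<^bsub>GL n\<^esub> A = B"
    using A B by (rule GL_inv_equality)
qed

lemma inv_GL_carrier_mat: "A \<in> carrier (GL n) \<Longrightarrow> inv\<^bsub>GL n\<^esub> A \<in> carrier_mat n n"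
  using GL_simps(2) carrier_GL by blast

section \<open>The unitary group\<close>

text \<open>Half of the defining condition suffices, since one-sided inverses of square matrices are
  two-sided.\<close>

lemma unitary_iff:
  "U \<in> carrier (unitary_group n) \<longleftrightarrow> U \<in> carrier_mat n n \<and> U * mat_adjoint U = 1\<^sub>m n"
  using mat_mult_left_right_inverse[of U n "mat_adjoint U"]
  by (auto simp: unitary_group_def)

lemma unitary_GL:
  assumes "U \<in> carrier (unitary_group n)"
  shows "U \<in> carrier (GL n)" "inv\<^bsub>GL n\<^esub> U = mat_adjoint U"
  using assms right_inverse_GL[of U n "mat_adjoint U"] by (auto simp: unitary_iff)

lemma unitary_subgroup: "subgroup (carrier (unitary_group n)) (GL n)"
proof (rule group.subgroupI[OF GL_group])
  show "carrier (unitary_group n) \<subseteq> carrier (GL n)" using unitary_GL by blast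
  have "mat_adjoint (1\<^sub>m n) = (1\<^sub>m n :: complex mat)"
    by (intro eq_matI) (auto simp: index_mat_adjoint[of _ n])
  then have "1\<^sub>m n \<in> carrier (unitary_group n)" by (simp add: unitary_iff)
  then show "carrier (unitary_group n) \<noteq> {}" by blast
next
  fix U assume U: "U \<in> carrier (unitary_group n)"
  then show "inv\<^bsub>GL n\<^esub> U \<in> carrier (unitary_group n)"
    by (auto simp: unitary_GL(2) mat_adjoint_adjoint unitary_group_def)
next
  fix U V assume U: "U \<in> carrier (unitary_group n)" and V: "V \<in> carrier (unitary_group n)"
  then have c: "U \<in> carrier_mat n n" "V \<in> carrier_mat n n" by (auto simp: unitary_iff)
  have "U * V * (mat_adjoint V * mat_adjoint U) = 1\<^sub>m n"
    using unitary_GL[OF U] unitary_GL[OF V] GL_inv_mult[of U n V] GL_simps(6)[of "U * V" n] by simp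
  then show "U \<otimes>\<^bsub>GL n\<^esub> V \<in> carrier (unitary_group n)"
    using c by (auto simp: mult_GL unitary_iff mat_adjoint_mult)
qed

section \<open>Lower triangular matrices with positive diagonal\<close>

text \<open>In the order on complex numbers \<open>0 < z\<close> means that z is real and positive,
  so one inequality replaces the two conditions on each diagonal entry.\<close>

lemma lower_iff:
  "L \<in> carrier (lower_group n) \<longleftrightarrow> L \<in> carrier_mat n n \<and>
    (\<forall>i<n. \<forall>j<n. i < j \<longrightarrow> L $$ (i, j) = 0) \<and> (\<forall>i<n. 0 < L $$ (i, i))"
  by (auto simp: lower_group_def less_complex_def)

lemma complex_pos_iff: "0 < (z::complex) \<longleftrightarrow> (\<exists>r>0. z = of_real r)"
  by (auto simp: less_complex_def complex_eq_iff intro!: exI[of _ "Re z"])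

lemma complex_mult_pos: "0 < (z::complex) \<Longrightarrow> 0 < w \<Longrightarrow> 0 < z * w"
  by (auto simp: less_complex_def)

text \<open>The determinant is the product of the diagonal entries. Positivity, which is more than
  invertibility, later forces equivalent unitary matrices to have equal determinants.\<close>

lemma lower_det_pos:
  assumes "L \<in> carrier (lower_group n)"
  shows "0 < det L"
proof -
  have pos: "(\<And>x. x \<in> set xs \<Longrightarrow> 0 < x) \<Longrightarrow> 0 < prod_list (xs :: complex list)" for xs
    by (induction xs) (auto simp: complex_mult_pos, simp add: less_complex_def)
  have "det L = prod_list (diag_mat L)"
    using assms by (intro det_lower_triangular[of n]) (auto simp: lower_iff)
  moreover have "0 < x" if "x \<in> set (diag_mat L)" for x
    using that assms by (auto simp: lower_iff diag_mat_def)
  ultimately show ?thesis using pos by metis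
qed

lemma lower_GL: "L \<in> carrier (lower_group n) \<Longrightarrow> L \<in> carrier (GL n)"
  using lower_det_pos[of L n] by (auto simp: carrier_GL lower_iff)

text \<open>Row \<open>i\<close> of \<open>L\<close> vanishes to the right of the diagonal.
  Truncating the sum there drives the triangular arguments below.\<close>

lemma index_lower_mult:
  assumes L: "L \<in> carrier (lower_group n)" and A: "A \<in> carrier_mat n k" and "i < n" "j < k"
  shows "(L * A) $$ (i, j) = (\<Sum>t\<le>i. L $$ (i, t) * A $$ (t, j))"
proof -
  have "(L * A) $$ (i, j) = (\<Sum>t<n. L $$ (i, t) * A $$ (t, j))"
    using assms by (intro index_mult_mat_sum[where n = n and k = k]) (auto simp: lower_iff)
  also have "\<dots> = (\<Sum>t\<le>i. L $$ (i, t) * A $$ (t, j))"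
    using assms by (intro sum.mono_neutral_right) (auto simp: lower_iff not_le)
  finally show ?thesis .
qed

text \<open>Forward substitution in each column: once the entries of column \<open>j\<close> of
  \<open>N\<close> above row \<open>i\<close> vanish, the equation
  \<open>L * N = 1\<^sub>m n\<close> at (i, j) has a single term left. It kills the entries above
  the diagonal and makes the diagonal entries reciprocals of those of \<open>L\<close>.\<close>

lemma lower_right_inverse:
  assumes L: "L \<in> carrier (lower_group n)" and N: "N \<in> carrier_mat n n" and LN: "L * N = 1\<^sub>m n"
  shows "N \<in> carrier (lower_group n)"
proof -
  have step: "L $$ (i, i) * N $$ (i, j) = (if i = j then 1 else 0)"
    if "i < n" "j < n" "\<And>t. t < i \<Longrightarrow> N $$ (t, j) = 0" for i j
  proof -
    have "(if i = j then 1 else 0) = (\<Sum>t\<le>i. L $$ (i, t) * N $$ (t, j))"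
      using that index_lower_mult[OF L N that(1,2)] LN by simp
    also have "\<dots> = L $$ (i, i) * N $$ (i, j)"
      using that by (simp add: lessThan_Suc_atMost[symmetric])
    finally show ?thesis by simp
  qed
  have Lii: "0 < L $$ (i, i)" if "i < n" for i using L that by (auto simp: lower_iff)
  have zero: "i < j \<Longrightarrow> j < n \<Longrightarrow> N $$ (i, j) = 0" for i j
  proof (induction i rule: less_induct)
    case (less i)
    then show ?case using step[of i j] Lii[of i] by auto
  qed
  have "0 < N $$ (i, i)" if i: "i < n" for i
  proof -
    obtain r where r: "r > 0" "L $$ (i, i) = of_real r"
      using Lii[OF i] complex_pos_iff by blast
    have "L $$ (i, i) * N $$ (i, i) = 1" using step[OF i i] zero i by simp
    then have "N $$ (i, i) = of_real (1 / r)" using r by (simp add: field_simps)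
    then show ?thesis using r by (auto simp: less_complex_def)
  qed
  then show ?thesis using zero N by (auto simp: lower_iff)
qed

lemma lower_subgroup: "subgroup (carrier (lower_group n)) (GL n)"
proof (rule group.subgroupI[OF GL_group])
  show "carrier (lower_group n) \<subseteq> carrier (GL n)" using lower_GL by blast
  have "1\<^sub>m n \<in> carrier (lower_group n)" by (auto simp: lower_iff less_complex_def)
  then show "carrier (lower_group n) \<noteq> {}" by blast
next
  fix L assume L: "L \<in> carrier (lower_group n)"
  then show "inv\<^bsub>GL n\<^esub> L \<in> carrier (lower_group n)"
    using GL_simps(6)[OF lower_GL[OF L]] inv_GL_carrier_mat[OF lower_GL[OF L]]
    by (intro lower_right_inverse[OF L]) auto
next
  fix L M assume L: "L \<in> carrier (lower_group n)" and M: "M \<in> carrier (lower_group n)"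
  have c: "L \<in> carrier_mat n n" "M \<in> carrier_mat n n" using L M by (auto simp: lower_iff)
  have "(L * M) $$ (i, j) = 0" if "i < j" "j < n" for i j
    using that M by (subst index_lower_mult[OF L c(2)]) (auto simp: lower_iff intro!: sum.neutral)
  moreover have "0 < (L * M) $$ (i, i)" if "i < n" for i
  proof -
    have "(L * M) $$ (i, i) = L $$ (i, i) * M $$ (i, i)"
      using that M by (subst index_lower_mult[OF L c(2)])
        (auto simp: lower_iff lessThan_Suc_atMost[symmetric])
    then show ?thesis using L M that by (simp add: complex_mult_pos lower_iff)
  qed
  ultimately show "L \<otimes>\<^bsub>GL n\<^esub> M \<in> carrier (lower_group n)"
    using c by (auto simp: mult_GL lower_iff simp del: index_mult_mat(1))
qed

section \<open>Existence and uniqueness of the factorization\<close>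

text \<open>The adjoint is the inverse and hence lower triangular too, so \<open>L\<close> is
  diagonal. Its diagonal entries are positive and of modulus 1.\<close>

lemma lower_unitary_trivial:
  assumes L: "L \<in> carrier (lower_group n)" and U: "L \<in> carrier (unitary_group n)"
  shows "L = 1\<^sub>m n"
proof -
  have c: "L \<in> carrier_mat n n" and c': "mat_adjoint L \<in> carrier_mat n n"
    using L by (auto simp: lower_iff)
  have adj: "mat_adjoint L \<in> carrier (lower_group n)"
    using lower_right_inverse[OF L c'] U by (simp add: unitary_iff)
  have off: "L $$ (i, j) = 0" if "i < n" "j < n" "i \<noteq> j" for i j
  proof (cases "i < j")
    case True
    then show ?thesis using L that by (auto simp: lower_iff)
  next
    case False
    then have "mat_adjoint L $$ (j, i) = 0" using adj that by (auto simp: lower_iff)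
    then show ?thesis using that index_mat_adjoint[OF c, of j i] by simp
  qed
  have diag: "L $$ (i, i) = 1" if "i < n" for i
  proof -
    have "1 = (L * mat_adjoint L) $$ (i, i)" using U that by (simp add: unitary_iff)
    also have "\<dots> = (\<Sum>t<n. L $$ (i, t) * mat_adjoint L $$ (t, i))"
      using c c' that by (intro index_mult_mat_sum[where n = n and k = n]) auto
    also have "\<dots> = (\<Sum>t\<in>{i}. L $$ (i, t) * mat_adjoint L $$ (t, i))"
      using that off by (intro sum.mono_neutral_right) auto
    also have "\<dots> = L $$ (i, i) * cnj (L $$ (i, i))"
      using that index_mat_adjoint[OF c, of i i] by simp
    finally have sq: "L $$ (i, i) * cnj (L $$ (i, i)) = 1" by simp
    have "0 < L $$ (i, i)" using L that by (simp add: lower_iff)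
    then obtain r where "r > 0" "L $$ (i, i) = of_real r"
      using complex_pos_iff by blast
    moreover have "r = 1" if "r > 0" "r * r = 1" for r :: real
      using that by (metis abs_of_pos real_sqrt_abs2 real_sqrt_one)
    ultimately show ?thesis using sq by (metis complex_cnj_complex_of_real of_real_1 of_real_eq_iff of_real_mult)
  qed
  show ?thesis using c off diag by (intro eq_matI) auto
qed

text \<open>Gram--Schmidt on the rows of \<open>b\<close>, one row per induction step.\<close>

lemma lower_orthonormalize:
  assumes b: "b \<in> carrier (GL n)" and "k \<le> n"
  shows "\<exists>l \<in> carrier (lower_group n). \<forall>i<k. \<forall>j<k.
    ((l * b) * mat_adjoint (l * b)) $$ (i, j) = (if i = j then 1 else 0)"
  using \<open>k \<le> n\<close>
proof (induction k)
  case 0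
  then show ?case using subgroup.one_closed[OF lower_subgroup, of n] by auto
next
  case (Suc k)
  then obtain l where l: "l \<in> carrier (lower_group n)" and
    orth: "\<And>i j. i < k \<Longrightarrow> j < k \<Longrightarrow> ((l * b) * mat_adjoint (l * b)) $$ (i, j) = (if i = j then 1 else 0)"
    by auto
  have k: "k < n" using Suc.prems by simp
  define A where "A = l * b"
  have bc: "b \<in> carrier_mat n n" using b by (simp add: carrier_GL)
  have lc: "l \<in> carrier_mat n n" using l by (simp add: lower_iff)
  have Ac: "A \<in> carrier_mat n n" using bc lc by (simp add: A_def)
  have gram: "(B * mat_adjoint B) $$ (i, j) = (\<Sum>t<n. B $$ (i, t) * cnj (B $$ (j, t)))"
    if "B \<in> carrier_mat n n" "i < n" "j < n" for B i j
    using that by (subst index_mult_mat_sum[of _ n n _ n]) (auto simp: index_mat_adjoint[of _ n] intro!: sum.cong)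
  have orthA: "(\<Sum>t<n. A $$ (i, t) * cnj (A $$ (j, t))) = (if i = j then 1 else 0)" if "i < k" "j < k" for i j
    using orth[OF that] gram[OF Ac, of i j] that k by (simp add: A_def)
  \<comment> \<open>These are the inner products of row \<open>k\<close> with the earlier
    orthonormal rows. Subtracting the projections leaves the residual row \<open>v\<close>, of
    squared norm \<open>s\<close>.\<close>
  define c where "c j = (\<Sum>t<n. A $$ (k, t) * cnj (A $$ (j, t)))" for j
  define v where "v t = A $$ (k, t) - (\<Sum>j<k. c j * A $$ (j, t))" for t
  define s where "s = (\<Sum>t<n. (cmod (v t))\<^sup>2)"
  \<comment> \<open>Left multiplication by \<open>E\<close> replaces row \<open>k\<close> of
    \<open>A\<close> by \<open>v\<close> and keeps all other rows; \<open>D\<close> below then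
    normalizes that row. Both lie in the lower triangular group.\<close>
  define E where "E = mat n n (\<lambda>(i, j). if i = k then (if j = k then 1 else if j < k then - c j else 0)
     else if i = j then 1 else (0::complex))"
  have E: "E \<in> carrier (lower_group n)"
    unfolding lower_iff by (auto simp: E_def less_complex_def)
  have Ec: "E \<in> carrier_mat n n" by (simp add: E_def)
  have EAk: "(E * A) $$ (k, t) = v t" if "t < n" for t
  proof -
    have "(E * A) $$ (k, t) = (\<Sum>j<Suc k. E $$ (k, j) * A $$ (j, t))"
      using index_lower_mult[OF E Ac k that] by (simp add: lessThan_Suc_atMost)
    also have "\<dots> = A $$ (k, t) + (\<Sum>j<k. - c j * A $$ (j, t))"
      using k by (simp add: E_def)
    finally show ?thesis by (simp add: v_def sum_negf)
  qed
  \<comment> \<open>A zero residual would be a zero row of the invertible matrix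
    \<open>E * A\<close>.\<close>
  have "s \<noteq> 0"
  proof
    assume "s = 0"
    then have v0: "v t = 0" if "t < n" for t
      using that by (simp add: s_def sum_nonneg_eq_0_iff)
      have EA: "E * A \<in> carrier (GL n)"
      using lower_GL[OF E] lower_GL[OF l] b by (auto simp: A_def)
    define N where "N = inv\<^bsub>GL n\<^esub> (E * A)"
    have "1 = (E * A * N) $$ (k, k)"
      using GL_simps(6)[OF EA] k by (simp add: N_def)
    also have "\<dots> = (\<Sum>t<n. (E * A) $$ (k, t) * N $$ (t, k))"
      using Ec Ac k inv_GL_carrier_mat[OF EA] by (intro index_mult_mat_sum[where n = n and k = n]) (auto simp: N_def)
    also have "\<dots> = 0" using EAk v0 by (intro sum.neutral) simp
    finally show False by simp
  qed
  then have s: "s > 0" unfolding s_def by (metis less_eq_real_def sum_nonneg zero_le_power2)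
  define D where "D = mat n n (\<lambda>(i, j). if i = j then (if i = k then of_real (1 / sqrt s) else 1) else (0::complex))"
  have D: "D \<in> carrier (lower_group n)"
    unfolding lower_iff using s by (auto simp: D_def less_complex_def)
  define B where "B = D * (E * A)"
  have Bc: "B \<in> carrier_mat n n" using Ec Ac by (auto simp: B_def D_def)
  have EAc: "E * A \<in> carrier_mat n n" using Ec Ac by simp
  have DM: "(D * M) $$ (i, t) = D $$ (i, i) * M $$ (i, t)" if "M \<in> carrier_mat n n" "i < n" "t < n" for M i t
  proof -
    have "(D * M) $$ (i, t) = (\<Sum>j<Suc i. D $$ (i, j) * M $$ (j, t))"
      using index_lower_mult[OF D that] by (simp add: lessThan_Suc_atMost)
    then show ?thesis using that by (simp add: D_def)
  qed
  have Bk: "B $$ (k, t) = v t / of_real (sqrt s)" if "t < n" for t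
    using DM[OF EAc k that] EAk that k by (simp add: B_def D_def)
  have Bi: "B $$ (i, t) = A $$ (i, t)" if "i < n" "i \<noteq> k" "t < n" for i t
  proof -
    have "B $$ (i, t) = (E * A) $$ (i, t)" 
      unfolding B_def by (subst DM[OF EAc]) (use that in \<open>auto simp: D_def simp del: index_mult_mat(1)\<close>)
    also have "\<dots> = (\<Sum>j<Suc i. E $$ (i, j) * A $$ (j, t))"
      using index_lower_mult[OF E Ac that(1,3)] by (simp add: lessThan_Suc_atMost)
    also have "\<dots> = A $$ (i, t)" using that by (simp add: E_def)
    finally show ?thesis .
  qed
  have vA: "(\<Sum>t<n. v t * cnj (A $$ (i, t))) = 0" if "i < k" for i
  proof -
    have "(\<Sum>t<n. v t * cnj (A $$ (i, t))) = c i - (\<Sum>t<n. \<Sum>j<k. c j * A $$ (j, t) * cnj (A $$ (i, t)))"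
      by (simp add: v_def c_def left_diff_distrib sum_subtractf sum_distrib_right)
    also have "(\<Sum>t<n. \<Sum>j<k. c j * A $$ (j, t) * cnj (A $$ (i, t))) =
        (\<Sum>j<k. c j * (\<Sum>t<n. A $$ (j, t) * cnj (A $$ (i, t))))"
      by (subst sum.swap) (simp add: sum_distrib_left mult.assoc)
    also have "\<dots> = (\<Sum>j<k. c j * (if j = i then 1 else 0))"
      using that by (intro sum.cong refl) (simp add: orthA)
    also have "\<dots> = c i" using that by (simp add: if_distrib cong: if_cong)
    finally show ?thesis by simp
  qed
  have BkA: "(\<Sum>t<n. B $$ (k, t) * cnj (A $$ (i, t))) = 0" if "i < k" for i
  proof -
    have "(\<Sum>t<n. B $$ (k, t) * cnj (A $$ (i, t))) = (\<Sum>t<n. v t * cnj (A $$ (i, t))) / of_real (sqrt s)"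
      by (simp add: Bk sum_divide_distrib)
    then show ?thesis using vA[OF that] by simp
  qed
  have BB: "(\<Sum>t<n. B $$ (i, t) * cnj (B $$ (j, t))) = (if i = j then 1 else 0)" if "i < Suc k" "j < Suc k" for i j
  proof -
    consider "i < k" "j < k" | "i = k" "j < k" | "i < k" "j = k" | "i = k" "j = k"
      using \<open>i < Suc k\<close> \<open>j < Suc k\<close> by (metis less_SucE)
    then show ?thesis
    proof cases
      case 1
      then show ?thesis using k orthA by (simp add: Bi)
    next
      case 2
      then show ?thesis using k BkA by (simp add: Bi)
    next
      case 3
      then have "(\<Sum>t<n. B $$ (i, t) * cnj (B $$ (j, t))) = cnj (\<Sum>t<n. B $$ (k, t) * cnj (A $$ (i, t)))"
        using k by (simp add: Bi mult.commute)
      then show ?thesis using 3 BkA by simp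
    next
      case 4
      have "B $$ (k, t) * cnj (B $$ (k, t)) = of_real ((cmod (v t))\<^sup>2 / s)" if "t < n" for t
      proof -
        have "complex_of_real (sqrt s) * of_real (sqrt s) = of_real s"
          using s by (simp flip: of_real_mult)
        then show ?thesis using that by (simp add: Bk complex_norm_square flip: of_real_power)
      qed
      then have "(\<Sum>t<n. B $$ (k, t) * cnj (B $$ (k, t))) = (\<Sum>t<n. of_real ((cmod (v t))\<^sup>2 / s))"
        by (intro sum.cong refl) blast
      also have "\<dots> = of_real (\<Sum>t<n. (cmod (v t))\<^sup>2 / s)"
        by (rule of_real_sum[symmetric])
      also have "(\<Sum>t<n. (cmod (v t))\<^sup>2 / s) = s / s"
        using s_def sum_divide_distrib[of "\<lambda>t. (cmod (v t))\<^sup>2" "{..<n}" s] by simp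
      finally have "(\<Sum>t<n. B $$ (k, t) * cnj (B $$ (k, t))) = of_real (s / s)" .
      then show ?thesis using 4 s by simp
    qed
  qed
  have "D * (E * l) \<in> carrier (lower_group n)"
    using subgroup.m_closed[OF lower_subgroup] D E l by (metis mult_GL)
  moreover have "D * (E * l) * b = B"
    using lower_GL[OF D] lower_GL[OF E] lower_GL[OF l] b
    by (simp add: B_def A_def GL_assoc[where n = n])
  moreover have "(B * mat_adjoint B) $$ (i, j) = (if i = j then 1 else 0)" if "i < Suc k" "j < Suc k" for i j
    using BB[OF that] gram[OF Bc, of i j] that k by simp
  ultimately show ?case by metis
qed

text \<open>Orthonormalizing all rows gives a unitary \<open>l * b\<close>. The factors are then the
  inverse of \<open>l\<close> and the inverse of \<open>l * b\<close>.\<close>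

lemma lower_unitary_factorization:
  assumes "b \<in> carrier (GL n)"
  obtains p m where "p \<in> carrier (lower_group n)" "m \<in> carrier (unitary_group n)"
    "b = p * inv\<^bsub>GL n\<^esub> m"
proof -
  obtain l where l: "l \<in> carrier (lower_group n)" and
    orth: "\<And>i j. i < n \<Longrightarrow> j < n \<Longrightarrow> ((l * b) * mat_adjoint (l * b)) $$ (i, j) = (if i = j then 1 else 0)"
    using lower_orthonormalize[OF assms order_refl] by auto
  have c: "l * b \<in> carrier_mat n n"
    using assms l by (auto simp: carrier_GL lower_iff)
  have "l * b * mat_adjoint (l * b) = 1\<^sub>m n"
    using orth c
    by (intro eq_matI) (auto simp del: index_mult_mat(1))
  with c have U: "l * b \<in> carrier (unitary_group n)" by (simp add: unitary_iff)
  have "b = inv\<^bsub>GL n\<^esub> l * inv\<^bsub>GL n\<^esub> (inv\<^bsub>GL n\<^esub> (l * b))"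
    using lower_GL[OF l] assms by (simp flip: GL_assoc[where n = n])
  with that[of "inv\<^bsub>GL n\<^esub> l" "inv\<^bsub>GL n\<^esub> (l * b)"] show ?thesis
    using subgroup.m_inv_closed[OF lower_subgroup l] subgroup.m_inv_closed[OF unitary_subgroup U] by blast
qed

text \<open>Rearranging the equation shows that the quotient of the two triangular factors equals
  the quotient of the two unitary ones. It lies in both groups, so it is the identity.\<close>

lemma factorization_unique:
  assumes p: "p \<in> carrier (lower_group n)" "p' \<in> carrier (lower_group n)"
    and m: "m \<in> carrier (unitary_group n)" "m' \<in> carrier (unitary_group n)"
    and eq: "p * inv\<^bsub>GL n\<^esub> m = p' * inv\<^bsub>GL n\<^esub> m'"
  shows "p = p' \<and> m = m'"
proof -
  note G = lower_GL[OF p(1)] lower_GL[OF p(2)] unitary_GL(1)[OF m(1)] unitary_GL(1)[OF m(2)]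
  have "inv\<^bsub>GL n\<^esub> p' * p = inv\<^bsub>GL n\<^esub> p' * (p * inv\<^bsub>GL n\<^esub> m) * m"
    using G by (simp add: GL_assoc[where n = n])
  also have "\<dots> = inv\<^bsub>GL n\<^esub> m' * m"
    unfolding eq using G by (simp flip: GL_assoc[where n = n])
  finally have *: "inv\<^bsub>GL n\<^esub> p' * p = inv\<^bsub>GL n\<^esub> m' * m" .
  have "inv\<^bsub>GL n\<^esub> p' * p \<in> carrier (lower_group n)"
    using subgroup.m_closed[OF lower_subgroup subgroup.m_inv_closed[OF lower_subgroup p(2)] p(1)]
    by (simp add: mult_GL)
  moreover have "inv\<^bsub>GL n\<^esub> p' * p \<in> carrier (unitary_group n)"
    using subgroup.m_closed[OF unitary_subgroup subgroup.m_inv_closed[OF unitary_subgroup m(2)] m(1)]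
    by (simp add: mult_GL *)
  ultimately have "inv\<^bsub>GL n\<^esub> p' * p = 1\<^sub>m n" by (rule lower_unitary_trivial)
  moreover have "p = p' * (inv\<^bsub>GL n\<^esub> p' * p)" "m = m' * (inv\<^bsub>GL n\<^esub> m' * m)"
    using G by (simp_all flip: GL_assoc[where n = n])
  ultimately show ?thesis using G * by (metis GL_simps(8))
qed

text \<open>Uniqueness turns the definite descriptions into usable equations: exhibiting one
  factorization computes both parts.\<close>

lemma plus_minus_part_eq:
  assumes "p \<in> carrier (lower_group n)" "m \<in> carrier (unitary_group n)"
  shows "plus_part n (p * inv\<^bsub>GL n\<^esub> m) = p" "minus_part n (p * inv\<^bsub>GL n\<^esub> m) = m"
  unfolding plus_part_def minus_part_def using assms factorization_unique
  by (auto intro!: the_equality)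

section \<open>Equivalence under triangular factors\<close>

lemma lower_closed:
  assumes "L \<in> carrier (lower_group n)" "M \<in> carrier (lower_group n)"
  shows "L * M \<in> carrier (lower_group n)" "inv\<^bsub>GL n\<^esub> L \<in> carrier (lower_group n)"
  using assms subgroup.m_closed[OF lower_subgroup] subgroup.m_inv_closed[OF lower_subgroup]
  by (metis mult_GL)+

lemma unitary_closed:
  assumes "U \<in> carrier (unitary_group n)" "V \<in> carrier (unitary_group n)"
  shows "U * V \<in> carrier (unitary_group n)" "inv\<^bsub>GL n\<^esub> U \<in> carrier (unitary_group n)"
  using assms subgroup.m_closed[OF unitary_subgroup] subgroup.m_inv_closed[OF unitary_subgroup]
  by (metis mult_GL)+

lemma one_lower [simp]: "1\<^sub>m n \<in> carrier (lower_group n)"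
  using subgroup.one_closed[OF lower_subgroup] by (metis one_GL)

text \<open>The relation \<sim> of the introduction. The two triangular factors are independent of
  each other, so its classes are the orbits of a two-sided action of the lower triangular
  group.\<close>

definition lower_equiv :: "nat \<Rightarrow> complex mat \<Rightarrow> complex mat \<Rightarrow> bool" where
  "lower_equiv n A B \<longleftrightarrow> (\<exists>l \<in> carrier (lower_group n). \<exists>p \<in> carrier (lower_group n). B = l * A * p)"

lemma lower_equivI:
  "l \<in> carrier (lower_group n) \<Longrightarrow> p \<in> carrier (lower_group n) \<Longrightarrow> B = l * A * p \<Longrightarrow> lower_equiv n A B"
  by (auto simp: lower_equiv_def)

lemma lower_equivE:
  assumes "lower_equiv n A B"
  obtains l p where "l \<in> carrier (lower_group n)" "p \<in> carrier (lower_group n)" "B = l * A * p"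
  using assms by (auto simp: lower_equiv_def)

lemma lower_equiv_sym:
  assumes "lower_equiv n A B" "A \<in> carrier (GL n)"
  shows "lower_equiv n B A"
proof -
  obtain l p where lp: "l \<in> carrier (lower_group n)" "p \<in> carrier (lower_group n)" "B = l * A * p"
    using assms by (elim lower_equivE)
  have "A = inv\<^bsub>GL n\<^esub> l * B * inv\<^bsub>GL n\<^esub> p"
  proof -
    have "inv\<^bsub>GL n\<^esub> l * B * inv\<^bsub>GL n\<^esub> p = inv\<^bsub>GL n\<^esub> l * (l * A) * (p * inv\<^bsub>GL n\<^esub> p)"
      using lp(3) lower_GL[OF lp(1)] lower_GL[OF lp(2)] assms(2)
      by (simp add: GL_assoc[where n = n] del: GL_simps(6))
    also have "\<dots> = A"
      using lower_GL[OF lp(1)] lower_GL[OF lp(2)] assms(2) by (simp flip: GL_assoc[where n = n])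
    finally show ?thesis by simp
  qed
  with lp lower_closed show ?thesis by (intro lower_equivI) auto
qed

lemma lower_equiv_trans:
  assumes "lower_equiv n A B" "lower_equiv n B C" "A \<in> carrier (GL n)"
  shows "lower_equiv n A C"
proof -
  obtain l p where lp: "l \<in> carrier (lower_group n)" "p \<in> carrier (lower_group n)" "B = l * A * p"
    using assms(1) by (elim lower_equivE)
  obtain k q where kq: "k \<in> carrier (lower_group n)" "q \<in> carrier (lower_group n)" "C = k * B * q"
    using assms(2) by (elim lower_equivE)
  show ?thesis
    using lp kq lower_GL[OF lp(1)] lower_GL[OF lp(2)] lower_GL[OF kq(1)] lower_GL[OF kq(2)] assms(3)
    by (intro lower_equivI[of "k * l" n "p * q"]) (simp_all add: lower_closed GL_assoc[where n = n])
qed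

text \<open>The two determinants differ by the positive factor \<open>det l * det p\<close>. Both
  have modulus 1, so this factor is 1.\<close>

lemma lower_equiv_det:
  assumes "lower_equiv n A B" "A \<in> carrier (unitary_group n)" "B \<in> carrier (unitary_group n)"
  shows "det A = det B"
proof -
  have unit: "cmod (det U) = 1" if U: "U \<in> carrier (unitary_group n)" for U
  proof -
    have Uc: "U \<in> carrier_mat n n" using U by (simp add: unitary_iff)
    interpret comm_ring_hom cnj by unfold_locales auto
    \<comment> \<open>In this form the determinant of the adjoint is seen to be the conjugate of
      \<open>det U\<close>, because conjugation is a ring homomorphism.\<close>
    have "mat_adjoint U = transpose_mat (map_mat cnj U)"
      using Uc by (intro eq_matI) (simp_all add: index_mat_adjoint[of U n])
    then have "det (mat_adjoint U) = cnj (det U)"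
      using Uc by (simp add: det_transpose[of _ n] hom_det)
    then have "det U * cnj (det U) = 1"
      using U Uc det_mult[of U n "mat_adjoint U"] by (simp add: unitary_iff)
    then have "complex_of_real ((cmod (det U))\<^sup>2) = of_real 1"
      by (simp only: complex_norm_square of_real_1)
    then have "(cmod (det U))\<^sup>2 = 1" by (simp only: of_real_eq_iff)
    then show ?thesis by (metis abs_norm_cancel abs_1 power2_eq_iff abs_square_eq_1)
  qed
  obtain l p where lp: "l \<in> carrier (lower_group n)" "p \<in> carrier (lower_group n)" "B = l * A * p"
    using assms(1) by (elim lower_equivE)
  have c: "l \<in> carrier_mat n n" "A \<in> carrier_mat n n" "p \<in> carrier_mat n n" "l * A \<in> carrier_mat n n"
    using lp assms(2) by (auto simp: lower_iff unitary_iff)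
  have "det B = (det l * det p) * det A"
    using det_mult[OF c(4,3)] det_mult[OF c(1,2)] lp(3) by simp
  moreover obtain r where r: "r > 0" "det l * det p = of_real r"
    using complex_mult_pos[OF lower_det_pos[OF lp(1)] lower_det_pos[OF lp(2)]] complex_pos_iff by auto
  ultimately have *: "det B = of_real r * det A" by simp
  then have "r = 1" using unit[OF assms(2)] unit[OF assms(3)] r(1) by (simp add: norm_mult)
  then show ?thesis using * by simp
qed

text \<open>Transposing \<open>B = l * A * p\<close> directly would produce upper triangular
  factors. For unitary matrices, however, the transpose is the entrywise conjugate of the inverse,
  and both inversion and conjugation preserve the lower triangular group. The factors trade sides in
  the process.\<close>

lemma lower_equiv_transpose:
  assumes AB: "lower_equiv n A B" and A: "A \<in> carrier (unitary_group n)" and B: "B \<in> carrier (unitary_group n)"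
  shows "lower_equiv n (transpose_mat A) (transpose_mat B)"
proof -
  obtain l p where lp: "l \<in> carrier (lower_group n)" "p \<in> carrier (lower_group n)" "B = l * A * p"
    using AB by (elim lower_equivE)
  interpret comm_ring_hom cnj by unfold_locales auto
  have tr: "transpose_mat U = map_mat cnj (inv\<^bsub>GL n\<^esub> U)" if U: "U \<in> carrier (unitary_group n)" for U
    using U by (intro eq_matI) (auto simp: unitary_GL(2) index_mat_adjoint[of U n] unitary_iff)
  have cl: "map_mat cnj (inv\<^bsub>GL n\<^esub> L) \<in> carrier (lower_group n)" if "L \<in> carrier (lower_group n)" for L
    using lower_closed(2)[OF that that] by (auto simp: lower_iff less_complex_def)
  define l' A' p' where "l' = inv\<^bsub>GL n\<^esub> l" and "A' = inv\<^bsub>GL n\<^esub> A" and "p' = inv\<^bsub>GL n\<^esub> p"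
  have G: "l \<in> carrier (GL n)" "A \<in> carrier (GL n)" "p \<in> carrier (GL n)"
    using lp A lower_GL unitary_GL by auto
  have c: "l' \<in> carrier_mat n n" "A' \<in> carrier_mat n n" "p' \<in> carrier_mat n n"
    using G by (simp_all add: l'_def A'_def p'_def inv_GL_carrier_mat)
  have c4: "p' * A' \<in> carrier_mat n n" using c by (intro mult_carrier_mat[of _ n n])
  have "inv\<^bsub>GL n\<^esub> B = p' * A' * l'"
    using G lp(3) by (simp add: GL_inv_mult[where n = n] l'_def A'_def p'_def GL_assoc[where n = n])
  then have "transpose_mat B = map_mat cnj p' * transpose_mat A * map_mat cnj l'"
    using tr[OF B] tr[OF A] mat_hom_mult[OF c4 c(1)] mat_hom_mult[OF c(3,2)] by (simp add: A'_def)
  then show ?thesis using cl lp by (intro lower_equivI) (auto simp: l'_def p'_def)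
qed

lemma unitary_transpose:
  assumes U: "U \<in> carrier (unitary_group n)"
  shows "transpose_mat U \<in> carrier (unitary_group n)"
proof -
  have c: "U \<in> carrier_mat n n" using U by (simp add: unitary_iff)
  have "mat_adjoint (transpose_mat U) = transpose_mat (mat_adjoint U)"
    using c by (intro eq_matI) (simp_all add: index_mat_adjoint[of _ n])
  then have "transpose_mat U * mat_adjoint (transpose_mat U) = transpose_mat (mat_adjoint U * U)"
    using c transpose_mult[of "mat_adjoint U" n n U n] by simp
  moreover have "mat_adjoint U * U = 1\<^sub>m n" using U by (simp add: unitary_group_def)
  ultimately show ?thesis using c by (simp add: unitary_iff)
qed

section \<open>Direct sums and the CMV recursion\<close>

text \<open>The direct sum \<oplus>, with its zero blocks written exactly as in
  \<open>diag_block_mat\<close>, so that block diagonal matrices unfold to nested direct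
  sums.\<close>

definition mat_sum :: "complex mat \<Rightarrow> complex mat \<Rightarrow> complex mat" where
  "mat_sum A B = four_block_mat A (0\<^sub>m (dim_row A) (dim_col B)) (0\<^sub>m (dim_row B) (dim_col A)) B"

lemma dim_mat_sum [simp]:
  "dim_row (mat_sum A B) = dim_row A + dim_row B" "dim_col (mat_sum A B) = dim_col A + dim_col B"
  by (simp_all add: mat_sum_def)

lemma mat_sum_carrier [simp]:
  "A \<in> carrier_mat n n \<Longrightarrow> B \<in> carrier_mat m m \<Longrightarrow> mat_sum A B \<in> carrier_mat (n + m) (n + m)"
  by (auto simp: mat_sum_def)

lemma mat_sum_carrierD:
  assumes "mat_sum A B \<in> carrier_mat (n + m) (n + m)" "A \<in> carrier_mat n n"
  shows "B \<in> carrier_mat m m"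
  using carrier_matD[OF assms(1)] carrier_matD[OF assms(2)] by (intro carrier_matI) auto

lemma mat_sum_mult:
  assumes "A \<in> carrier_mat n n" "B \<in> carrier_mat n n" "C \<in> carrier_mat m m" "D \<in> carrier_mat m m"
  shows "mat_sum A C * mat_sum B D = mat_sum (A * B) (C * D)"
proof -
  have "four_block_mat A (0\<^sub>m n m) (0\<^sub>m m n) C * four_block_mat B (0\<^sub>m n m) (0\<^sub>m m n) D =
      four_block_mat (A * B + 0\<^sub>m n m * 0\<^sub>m m n) (A * 0\<^sub>m n m + 0\<^sub>m n m * D)
        (0\<^sub>m m n * B + C * 0\<^sub>m m n) (0\<^sub>m m n * 0\<^sub>m n m + C * D)"
    by (rule mult_four_block_mat[OF assms(1) zero_carrier_mat zero_carrier_mat assms(3)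
      assms(2) zero_carrier_mat zero_carrier_mat assms(4)])
  also have "\<dots> = four_block_mat (A * B) (0\<^sub>m n m) (0\<^sub>m m n) (C * D)"
  proof (rule cong_four_block_mat)
    have AB: "A * B \<in> carrier_mat n n" and CD: "C * D \<in> carrier_mat m m"
      using assms by (metis mult_carrier_mat)+
    show "A * B + 0\<^sub>m n m * 0\<^sub>m m n = A * B"
      using right_add_zero_mat[OF AB] left_mult_zero_mat[OF zero_carrier_mat[of m n], of n] by simp
    show "0\<^sub>m m n * 0\<^sub>m n m + C * D = C * D"
      using left_add_zero_mat[OF CD] left_mult_zero_mat[OF zero_carrier_mat[of n m], of m] by simp
    show "A * 0\<^sub>m n m + 0\<^sub>m n m * D = 0\<^sub>m n m"
      using right_mult_zero_mat[OF assms(1), of m] left_mult_zero_mat[OF assms(4), of n] by simp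
    show "0\<^sub>m m n * B + C * 0\<^sub>m m n = 0\<^sub>m m n"
      using right_mult_zero_mat[OF assms(3), of n] left_mult_zero_mat[OF assms(2), of m] by simp
  qed
  finally show ?thesis using assms by (simp add: mat_sum_def)
qed

lemma mat_sum_one [simp]: "mat_sum (1\<^sub>m n) (1\<^sub>m m) = 1\<^sub>m (n + m)"
  by (simp add: mat_sum_def)

lemma mat_sum_assoc: "mat_sum A (mat_sum B C) = mat_sum (mat_sum A B) C"
  unfolding mat_sum_def by (rule assoc_four_block_mat)

lemma transpose_mat_sum:
  "transpose_mat (mat_sum A B) = mat_sum (transpose_mat A) (transpose_mat B)"
  unfolding mat_sum_def by (intro eq_matI) auto

lemma mat_adjoint_mat_sum:
  assumes "A \<in> carrier_mat n n" "B \<in> carrier_mat m m"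
  shows "mat_adjoint (mat_sum A B) = mat_sum (mat_adjoint A) (mat_adjoint B)"
  using assms
  by (intro eq_matI)
    (auto simp: index_mat_adjoint[of _ "n + m"] index_mat_adjoint[of _ n] index_mat_adjoint[of _ m] mat_sum_def)

lemma unitary_mat_sum:
  assumes "A \<in> carrier (unitary_group n)" "B \<in> carrier (unitary_group m)"
  shows "mat_sum A B \<in> carrier (unitary_group (n + m))"
  using assms
  by (auto simp: unitary_iff mat_adjoint_mat_sum[of _ n _ m] mat_sum_mult[of _ n _ _ m])

lemma lower_mat_sum:
  assumes "A \<in> carrier (lower_group n)" "B \<in> carrier (lower_group m)"
  shows "mat_sum A B \<in> carrier (lower_group (n + m))"
  using assms by (auto simp: lower_iff mat_sum_def)

lemma det_mat_sum:
  assumes "A \<in> carrier_mat n n" "B \<in> carrier_mat m m"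
  shows "det (mat_sum A B) = det A * det B"
  using assms unfolding mat_sum_def
  by (intro det_four_block_mat_upper_right_zero[of _ n _ m]) auto

lemma diag_block_mat_Cons: "diag_block_mat (A # As) = mat_sum A (diag_block_mat As)"
  by (simp add: mat_sum_def Let_def)

section \<open>The two-by-two blocks\<close>

text \<open>The block \<Xi>(z) of the introduction, freed from the size and the coefficient sequence
  that \<open>cmv_Xi\<close> carries.\<close>

definition cmv_block :: "complex \<Rightarrow> complex mat" where
  "cmv_block z = mat_of_rows_list 2
    [[cnj z, of_real (sqrt (1 - (cmod z)\<^sup>2))], [of_real (sqrt (1 - (cmod z)\<^sup>2)), - z]]"

lemma mat2_simps [simp]:
  "mat_of_rows_list 2 [[a, b], [c, d]] \<in> carrier_mat 2 2"
  "mat_of_rows_list 2 [[a, b], [c, d]] $$ (0, 0) = a"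
  "mat_of_rows_list 2 [[a, b], [c, d]] $$ (0, Suc 0) = b"
  "mat_of_rows_list 2 [[a, b], [c, d]] $$ (Suc 0, 0) = c"
  "mat_of_rows_list 2 [[a, b], [c, d]] $$ (Suc 0, Suc 0) = d"
  by (auto simp: mat_of_rows_list_def)

lemma mat2_eqI:
  assumes "A \<in> carrier_mat 2 2" "B \<in> carrier_mat 2 2"
    "A $$ (0, 0) = B $$ (0, 0)" "A $$ (0, Suc 0) = B $$ (0, Suc 0)"
    "A $$ (Suc 0, 0) = B $$ (Suc 0, 0)" "A $$ (Suc 0, Suc 0) = B $$ (Suc 0, Suc 0)"
  shows "A = B"
  using assms by (intro eq_matI) (auto simp: less_2_cases_iff)

lemma lessThan_2: "{..<2::nat} = {0, Suc 0}"
  by auto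

lemma mat2_mult:
  fixes a b c d :: complex
  shows "mat_of_rows_list 2 [[a, b], [c, d]] * mat_of_rows_list 2 [[a', b'], [c', d']] =
   mat_of_rows_list 2 [[a * a' + b * c', a * b' + b * d'], [c * a' + d * c', c * b' + d * d']]"
  by (rule mat2_eqI, rule mult_carrier_mat[of _ 2 2])
    (simp_all add: index_mult_mat_sum[of _ 2 2 _ 2] lessThan_2 del: index_mult_mat(1))

lemma mat2_one: "mat_of_rows_list 2 [[1, 0], [0, 1]] = (1\<^sub>m 2 :: complex mat)"
  by (rule mat2_eqI) simp_all

lemma cmv_block_carrier [simp]: "cmv_block z \<in> carrier_mat 2 2"
  by (simp add: cmv_block_def)

lemma cmv_rho_square:
  assumes "cmod z \<le> 1"
  shows "complex_of_real (sqrt (1 - (cmod z)\<^sup>2)) * of_real (sqrt (1 - (cmod z)\<^sup>2)) = 1 - z * cnj z"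
proof -
  have "(cmod z)\<^sup>2 \<le> 1" using assms by (simp add: power_le_one)
  then have "complex_of_real (sqrt (1 - (cmod z)\<^sup>2)) * of_real (sqrt (1 - (cmod z)\<^sup>2)) = of_real (1 - (cmod z)\<^sup>2)"
    by (simp flip: of_real_mult)
  then show ?thesis using complex_norm_square[of z] by simp
qed

lemma mat_adjoint_cmv_block:
  "mat_adjoint (cmv_block z) = mat_of_rows_list 2
    [[z, of_real (sqrt (1 - (cmod z)\<^sup>2))], [of_real (sqrt (1 - (cmod z)\<^sup>2)), - cnj z]]"
  by (rule mat2_eqI) (simp_all add: index_mat_adjoint[of _ 2] cmv_block_def)

lemma unitary_cmv_block:
  assumes "cmod z \<le> 1"
  shows "cmv_block z \<in> carrier (unitary_group 2)"
proof -
  have "cmv_block z * mat_adjoint (cmv_block z) = mat_of_rows_list 2 [[1, 0], [0, 1]]"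
    unfolding mat_adjoint_cmv_block unfolding cmv_block_def mat2_mult
    by (simp add: cmv_rho_square[OF assms] mult.commute)
  then show ?thesis by (simp add: unitary_iff mat2_one)
qed

lemma cmv_Xi_block: "Suc k < n \<Longrightarrow> cmv_Xi n a k = cmv_block (a k)"
  by (simp add: cmv_Xi_def cmv_block_def cmv_rho_def)

text \<open>Symmetry of the blocks passes to \<open>cmv_L\<close> and \<open>cmv_M\<close>, which
  allows the product \<open>cmv_M\<close> times \<open>cmv_L\<close> to be read as the transpose of
  a CMV matrix.\<close>

lemma transpose_cmv_Xi: "transpose_mat (cmv_Xi n a k) = cmv_Xi n a k"
proof (cases "Suc k < n")
  case True
  then show ?thesis by (intro mat2_eqI) (simp_all add: cmv_Xi_def index_transpose_mat carrier_matD[OF mat2_simps(1)])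
next
  case False
  then have "cmv_Xi n a k = mat 1 1 (\<lambda>_. cnj (a k))"
    by (intro eq_matI) (simp_all add: cmv_Xi_def mat_of_rows_list_def)
  moreover have "transpose_mat (mat 1 1 (\<lambda>_. cnj (a k))) = mat 1 1 (\<lambda>_. cnj (a k))"
    by (rule eq_matI) simp_all
  ultimately show ?thesis by simp
qed

lemma transpose_diag_block_mat:
  assumes "\<And>A. A \<in> set As \<Longrightarrow> transpose_mat A = A"
  shows "transpose_mat (diag_block_mat As) = (diag_block_mat As :: complex mat)"
  using assms
proof (induction As)
  case Nil
  then show ?case by (intro eq_matI) auto
next
  case (Cons A As)
  then show ?case by (simp add: diag_block_mat_Cons transpose_mat_sum del: diag_block_mat.simps)
qed

lemma transpose_cmv_L: "transpose_mat (cmv_L n a) = cmv_L n a"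
  unfolding cmv_L_def by (rule transpose_diag_block_mat) (auto simp: transpose_cmv_Xi)

lemma transpose_cmv_M: "transpose_mat (cmv_M n a) = cmv_M n a"
  unfolding cmv_M_def by (rule transpose_diag_block_mat) (auto simp: transpose_cmv_Xi)

section \<open>The CMV recursion\<close>

text \<open>The size drops together with the index, so the one-by-one block remains the last
  one.\<close>

lemma cmv_Xi_Suc: "cmv_Xi (Suc n) a (Suc k) = cmv_Xi n (a \<circ> Suc) k"
  by (simp add: cmv_Xi_def cmv_rho_def)

lemma upt_Suc_map: "[0..<Suc n] = 0 # map Suc [0..<n]"
  by (simp add: map_Suc_upt upt_conv_Cons del: upt_Suc)

text \<open>Shifting the coefficients turns odd indices into even ones, so the blocks of
  \<open>cmv_M\<close> after its leading 1 are those of a smaller \<open>cmv_L\<close>.\<close>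

lemma cmv_M_Suc: "cmv_M (Suc n) a = mat_sum (1\<^sub>m 1) (cmv_L n (a \<circ> Suc))"
  unfolding cmv_M_def cmv_L_def upt_Suc_map
  by (simp add: diag_block_mat_Cons filter_map o_def cmv_Xi_Suc[unfolded o_def] del: diag_block_mat.simps)

text \<open>The shared remainder \<open>D\<close> collects the blocks of positive even index. After
  the shift these have odd index, and in \<open>cmv_M\<close> they follow the leading 1.\<close>

lemma cmv_L_Suc_Suc:
  "\<exists>D. cmv_L (Suc (Suc n)) a = mat_sum (cmv_block (a 0)) D \<and>
    cmv_M (Suc n) (a \<circ> Suc) = mat_sum (1\<^sub>m 1) D"
proof (intro exI conjI)
  let ?D = "diag_block_mat (map (cmv_Xi (Suc n) (a \<circ> Suc)) (filter odd [0..<Suc n]))"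
  show "cmv_M (Suc n) (a \<circ> Suc) = mat_sum (1\<^sub>m 1) ?D"
    unfolding cmv_M_def by (rule diag_block_mat_Cons)
  show "cmv_L (Suc (Suc n)) a = mat_sum (cmv_block (a 0)) ?D"
    unfolding cmv_L_def upt_Suc_map[of "Suc n"]
    by (simp add: diag_block_mat_Cons filter_map o_def cmv_Xi_Suc[unfolded o_def] cmv_Xi_block
        del: diag_block_mat.simps upt_Suc)
qed

lemma cmv_L_1: "cmv_L (Suc 0) a = mat 1 1 (\<lambda>_. cnj (a 0))"
proof -
  have "cmv_L (Suc 0) a = cmv_Xi (Suc 0) a 0"
    by (simp add: cmv_L_def diag_block_mat_singleton del: diag_block_mat.simps)
  also have "\<dots> = mat 1 1 (\<lambda>_. cnj (a 0))"
    by (rule eq_matI) (simp_all add: cmv_Xi_def mat_of_rows_list_def)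
  finally show ?thesis .
qed

text \<open>The induction goes in steps of two because the size of the remainder \<open>D\<close> is
  read off from the \<open>cmv_M\<close> of the shifted sequence, which is 1 \<oplus> the
  \<open>cmv_L\<close> of the sequence shifted twice.\<close>

lemma cmv_L_carrier: "cmv_L n a \<in> carrier_mat n n"
proof (induction n arbitrary: a rule: induct_nat_012)
  case 0
  show ?case by (simp add: cmv_L_def)
next
  case 1
  show ?case by (simp add: cmv_L_1)
next
  case (ge2 n)
  obtain D where D: "cmv_L (Suc (Suc n)) a = mat_sum (cmv_block (a 0)) D"
    "cmv_M (Suc n) (a \<circ> Suc) = mat_sum (1\<^sub>m 1) D"
    using cmv_L_Suc_Suc[of n a] by blast
  have "mat_sum (1\<^sub>m 1) (cmv_L n (a \<circ> Suc \<circ> Suc)) = mat_sum (1\<^sub>m 1) D"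
    using D(2) cmv_M_Suc[of n "a \<circ> Suc"] by simp
  then have "mat_sum (1\<^sub>m 1) D \<in> carrier_mat (1 + n) (1 + n)"
    using mat_sum_carrier[OF one_carrier_mat[of 1] ge2.IH(1), of "a \<circ> Suc \<circ> Suc"] by (simp add: o_def)
  then have "D \<in> carrier_mat n n" by (rule mat_sum_carrierD) simp
  with cmv_block_carrier have "mat_sum (cmv_block (a 0)) D \<in> carrier_mat (2 + n) (2 + n)"
    by (rule mat_sum_carrier)
  then show ?case by (simp only: D(1) add_2_eq_Suc)
qed

lemma cmv_M_carrier: "cmv_M (Suc n) a \<in> carrier_mat (Suc n) (Suc n)"
  using mat_sum_carrier[of "1\<^sub>m 1" 1 "cmv_L n (a \<circ> Suc)" n] by (simp add: cmv_M_Suc cmv_L_carrier)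

lemma cmv_matrix_carrier: "cmv_matrix (Suc n) a \<in> carrier_mat (Suc n) (Suc n)"
  using mult_carrier_mat[OF cmv_L_carrier cmv_M_carrier] by (simp add: cmv_matrix_def)

text \<open>\<open>m\<close> is the size of the identity next to the block, so \<open>X\<close> has
  size m + 1 and the result m + 2; the two factors overlap in the coordinate with index 1.\<close>

definition cmv_step :: "nat \<Rightarrow> complex \<Rightarrow> complex mat \<Rightarrow> complex mat" where
  "cmv_step m z X = mat_sum (cmv_block z) (1\<^sub>m m) * mat_sum (1\<^sub>m 1) X"

text \<open>Write b for the shifted sequence and L, M for the two block diagonal matrices. Then L(a)
  = (\<Xi>(a 0) \<oplus> 1)(1 \<oplus> M(b)) and M(a) = 1 \<oplus> L(b). The product therefore
  contains M(b) L(b), which is the transpose of L(b) M(b) since both are symmetric.\<close>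

lemma cmv_matrix_Suc_Suc:
  "cmv_matrix (Suc (Suc m)) a = cmv_step m (a 0) (transpose_mat (cmv_matrix (Suc m) (a \<circ> Suc)))"
proof -
  let ?b = "a \<circ> Suc"
  obtain D where D: "cmv_L (Suc (Suc m)) a = mat_sum (cmv_block (a 0)) D"
      "cmv_M (Suc m) ?b = mat_sum (1\<^sub>m 1) D"
    using cmv_L_Suc_Suc[of m a] by blast
  have "mat_sum (1\<^sub>m 1) D \<in> carrier_mat (1 + m) (1 + m)" using cmv_M_carrier[of m ?b] D by simp
  then have Dc: "D \<in> carrier_mat m m" by (rule mat_sum_carrierD) simp
  have L: "cmv_L (Suc m) ?b \<in> carrier_mat (Suc m) (Suc m)" by (rule cmv_L_carrier)
  have M: "cmv_M (Suc m) ?b \<in> carrier_mat (Suc m) (Suc m)" by (rule cmv_M_carrier)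
  have "cmv_L (Suc (Suc m)) a = mat_sum (cmv_block (a 0)) (1\<^sub>m m) * mat_sum (1\<^sub>m 2) D"
    using D(1) Dc by (simp add: mat_sum_mult[of _ 2 _ _ m] right_mult_one_mat[OF cmv_block_carrier])
  also have "mat_sum (1\<^sub>m 2) D = mat_sum (1\<^sub>m 1) (mat_sum (1\<^sub>m 1) D)"
    using mat_sum_one[of 1 1] by (simp add: mat_sum_assoc numeral_2_eq_2)
  finally have "cmv_matrix (Suc (Suc m)) a =
      mat_sum (cmv_block (a 0)) (1\<^sub>m m) * mat_sum (1\<^sub>m 1) (cmv_M (Suc m) ?b) *
      mat_sum (1\<^sub>m 1) (cmv_L (Suc m) ?b)"
    by (simp add: cmv_matrix_def cmv_M_Suc[of "Suc m" a] D(2))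
  also have "\<dots> = mat_sum (cmv_block (a 0)) (1\<^sub>m m) *
      (mat_sum (1\<^sub>m 1) (cmv_M (Suc m) ?b) * mat_sum (1\<^sub>m 1) (cmv_L (Suc m) ?b))"
    using mat_sum_carrier[OF cmv_block_carrier one_carrier_mat[of m]]
      mat_sum_carrier[OF one_carrier_mat[of 1] L] mat_sum_carrier[OF one_carrier_mat[of 1] M]
    by (intro assoc_mult_mat[of _ "2 + m" "2 + m" _ "2 + m" _ "2 + m"]) simp_all
  also have "mat_sum (1\<^sub>m 1) (cmv_M (Suc m) ?b) * mat_sum (1\<^sub>m 1) (cmv_L (Suc m) ?b) =
      mat_sum (1\<^sub>m 1) (cmv_M (Suc m) ?b * cmv_L (Suc m) ?b)"
    using L M by (simp add: mat_sum_mult[of _ 1 _ _ "Suc m"])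
  also have "cmv_M (Suc m) ?b * cmv_L (Suc m) ?b = transpose_mat (cmv_matrix (Suc m) ?b)"
    unfolding cmv_matrix_def using transpose_mult[OF L M] by (simp add: transpose_cmv_L transpose_cmv_M)
  finally show ?thesis by (simp add: cmv_step_def)
qed

lemma cmv_matrix_1: "cmv_matrix (Suc 0) a = mat 1 1 (\<lambda>_. cnj (a 0))"
proof -
  have "cmv_L 0 (a \<circ> Suc) = 1\<^sub>m 0" by (rule eq_matI) (simp_all add: cmv_L_def)
  then have "cmv_M (Suc 0) a = 1\<^sub>m 1" using mat_sum_one[of 1 0] by (simp add: cmv_M_Suc)
  then have "cmv_matrix (Suc 0) a = mat 1 1 (\<lambda>_. cnj (a 0)) * 1\<^sub>m 1"
    by (simp only: cmv_matrix_def cmv_L_1)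
  also have "\<dots> = mat 1 1 (\<lambda>_. cnj (a 0))" by (rule right_mult_one_mat[OF mat_carrier])
  finally show ?thesis .
qed

section \<open>Deleting the first row and column\<close>

text \<open>Stated with \<open>Suc 0\<close>, the normal form that the simplifier gives to
  1.\<close>

lemma mat_sum_one_index:
  assumes "X \<in> carrier_mat m m"
  shows "mat_sum (1\<^sub>m (Suc 0)) X $$ (0, 0) = 1"
    "j < m \<Longrightarrow> mat_sum (1\<^sub>m (Suc 0)) X $$ (0, Suc j) = 0"
    "i < m \<Longrightarrow> mat_sum (1\<^sub>m (Suc 0)) X $$ (Suc i, 0) = 0"
    "i < m \<Longrightarrow> j < m \<Longrightarrow> mat_sum (1\<^sub>m (Suc 0)) X $$ (Suc i, Suc j) = X $$ (i, j)"
  using carrier_matD[OF assms] by (simp_all add: mat_sum_def)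

lemma mat_sum_one_carrier:
  "X \<in> carrier_mat m m \<Longrightarrow> mat_sum (1\<^sub>m 1) X \<in> carrier_mat (Suc m) (Suc m)"
  using mat_sum_carrier[OF one_carrier_mat[of 1], of X m] by simp

lemma GL_mat_sum_one:
  assumes "X \<in> carrier (GL m)"
  shows "mat_sum (1\<^sub>m 1) X \<in> carrier (GL (Suc m))"
  using assms mat_sum_one_carrier[of X m] det_mat_sum[OF one_carrier_mat[of 1], of X m]
  by (simp add: carrier_GL)

text \<open>Compression to all coordinates but the first; it recovers X from 1 \<oplus> X.\<close>

definition lower_right :: "complex mat \<Rightarrow> complex mat" where
  "lower_right A = mat (dim_row A - 1) (dim_col A - 1) (\<lambda>(i, j). A $$ (Suc i, Suc j))"

lemma lower_right_carrier: "A \<in> carrier_mat (Suc m) (Suc m) \<Longrightarrow> lower_right A \<in> carrier_mat m m"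
  by (rule carrier_matI) (simp_all add: lower_right_def)

lemma index_lower_right:
  "A \<in> carrier_mat (Suc m) (Suc m) \<Longrightarrow> i < m \<Longrightarrow> j < m \<Longrightarrow> lower_right A $$ (i, j) = A $$ (Suc i, Suc j)"
  by (simp add: lower_right_def)

lemma lower_right_lower:
  assumes "L \<in> carrier (lower_group (Suc m))"
  shows "lower_right L \<in> carrier (lower_group m)"
proof -
  have "L \<in> carrier_mat (Suc m) (Suc m)" using assms by (simp add: lower_iff)
  then show ?thesis using assms lower_right_carrier by (simp add: lower_iff index_lower_right)
qed

text \<open>Compression is not multiplicative in general. It is when one factor is 1 \<oplus> Y,
  whose zeros keep the deleted row of \<open>A\<close> out of the sum; the mirrored version below
  treats the deleted column.\<close>

lemma lower_right_mult_left:
  assumes Y: "Y \<in> carrier_mat m m" and A: "A \<in> carrier_mat (Suc m) (Suc m)"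
  shows "lower_right (mat_sum (1\<^sub>m 1) Y * A) = Y * lower_right A"
proof (rule eq_matI)
  note Yc = mat_sum_one_carrier[OF Y]
  note YA = mult_carrier_mat[OF Yc A]
  note Ar = lower_right_carrier[OF A]
  fix i j assume "i < dim_row (Y * lower_right A)" "j < dim_col (Y * lower_right A)"
  then have ij: "i < m" "j < m" using Y Ar by simp_all
  have "lower_right (mat_sum (1\<^sub>m 1) Y * A) $$ (i, j) = (mat_sum (1\<^sub>m 1) Y * A) $$ (Suc i, Suc j)"
    using index_lower_right[OF YA ij] .
  also have "\<dots> = (\<Sum>t<Suc m. mat_sum (1\<^sub>m 1) Y $$ (Suc i, t) * A $$ (t, Suc j))"
    using ij by (intro index_mult_mat_sum[OF Yc A]) simp_all
  also have "\<dots> = (\<Sum>t<m. Y $$ (i, t) * lower_right A $$ (t, j))"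
    using ij by (simp add: sum.lessThan_Suc_shift mat_sum_one_index[OF Y] index_lower_right[OF A] del: sum.lessThan_Suc)
  also have "\<dots> = (Y * lower_right A) $$ (i, j)"
    using index_mult_mat_sum[OF Y Ar ij] ..
  finally show "lower_right (mat_sum (1\<^sub>m 1) Y * A) $$ (i, j) = (Y * lower_right A) $$ (i, j)" .
qed (use carrier_matD[OF Y] carrier_matD[OF A] in \<open>simp_all add: lower_right_def\<close>)

lemma lower_right_mult_right:
  assumes A: "A \<in> carrier_mat (Suc m) (Suc m)" and Y: "Y \<in> carrier_mat m m"
  shows "lower_right (A * mat_sum (1\<^sub>m 1) Y) = lower_right A * Y"
proof (rule eq_matI)
  note Yc = mat_sum_one_carrier[OF Y]
  note AY = mult_carrier_mat[OF A Yc]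
  note Ar = lower_right_carrier[OF A]
  fix i j assume "i < dim_row (lower_right A * Y)" "j < dim_col (lower_right A * Y)"
  then have ij: "i < m" "j < m" using Y Ar by simp_all
  have "lower_right (A * mat_sum (1\<^sub>m 1) Y) $$ (i, j) = (A * mat_sum (1\<^sub>m 1) Y) $$ (Suc i, Suc j)"
    using index_lower_right[OF AY ij] .
  also have "\<dots> = (\<Sum>t<Suc m. A $$ (Suc i, t) * mat_sum (1\<^sub>m 1) Y $$ (t, Suc j))"
    using ij by (intro index_mult_mat_sum[OF A Yc]) simp_all
  also have "\<dots> = (\<Sum>t<m. lower_right A $$ (i, t) * Y $$ (t, j))"
    using ij by (simp add: sum.lessThan_Suc_shift mat_sum_one_index[OF Y] index_lower_right[OF A] del: sum.lessThan_Suc)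
  also have "\<dots> = (lower_right A * Y) $$ (i, j)"
    using index_mult_mat_sum[OF Ar Y ij] ..
  finally show "lower_right (A * mat_sum (1\<^sub>m 1) Y) $$ (i, j) = (lower_right A * Y) $$ (i, j)" .
qed (use carrier_matD[OF Y] carrier_matD[OF A] in \<open>simp_all add: lower_right_def\<close>)

text \<open>One direction is the direct sum of unitary matrices; the other compresses the identity
  that says that 1 \<oplus> Y is unitary.\<close>

lemma unitary_mat_sum_one_iff:
  assumes Y: "Y \<in> carrier_mat m m"
  shows "mat_sum (1\<^sub>m 1) Y \<in> carrier (unitary_group (Suc m)) \<longleftrightarrow> Y \<in> carrier (unitary_group m)"
proof
  have one: "1\<^sub>m 1 \<in> carrier (unitary_group 1)"
    using subgroup.one_closed[OF unitary_subgroup, of 1] by (simp add: one_GL)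
  show "mat_sum (1\<^sub>m 1) Y \<in> carrier (unitary_group (Suc m))" if "Y \<in> carrier (unitary_group m)"
    using unitary_mat_sum[OF one that] by simp
  assume U: "mat_sum (1\<^sub>m 1) Y \<in> carrier (unitary_group (Suc m))"
  have adj: "mat_adjoint (1\<^sub>m 1) = (1\<^sub>m 1 :: complex mat)"
    by (rule eq_matI) (simp_all add: index_mat_adjoint[of _ 1])
  have Y': "mat_adjoint Y \<in> carrier_mat m m" using Y by (rule mat_adjoint_carrier)
  have "Y * mat_adjoint Y = lower_right (mat_sum (1\<^sub>m 1) Y * mat_sum (1\<^sub>m 1) (mat_adjoint Y))"
  proof -
    have "lower_right (mat_sum (1\<^sub>m 1) (mat_adjoint Y)) = mat_adjoint Y"
      using Y by (intro eq_matI) (simp_all add: lower_right_def mat_sum_one_index[OF Y'])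
    then show ?thesis using lower_right_mult_left[OF Y mat_sum_one_carrier[OF Y']] by simp
  qed
  also have "mat_sum (1\<^sub>m 1) Y * mat_sum (1\<^sub>m 1) (mat_adjoint Y) = 1\<^sub>m (Suc m)"
    using U mat_adjoint_mat_sum[OF one_carrier_mat[of 1] Y] adj by (simp add: unitary_iff)
  also have "lower_right (1\<^sub>m (Suc m)) = 1\<^sub>m m"
    by (rule eq_matI) (simp_all add: lower_right_def)
  finally show "Y \<in> carrier (unitary_group m)" using Y by (simp add: unitary_iff)
qed

section \<open>The coordinate swap\<close>

text \<open>At z = 0 the diagonal of \<Xi>(z) vanishes and its off-diagonal entries are 1, so the
  direct sum is a row swap matrix.\<close>

lemma cmv_block_0_swap: "mat_sum (cmv_block 0) (1\<^sub>m m) = swaprows_mat (Suc (Suc m)) 0 1"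
proof (rule eq_matI)
  fix i j assume "i < dim_row (swaprows_mat (Suc (Suc m)) 0 1 :: complex mat)"
    "j < dim_col (swaprows_mat (Suc (Suc m)) 0 1 :: complex mat)"
  then have ij: "i < Suc (Suc m)" "j < Suc (Suc m)" by simp_all
  note d = carrier_matD[OF cmv_block_carrier]
  have "i = 0 \<or> i = Suc 0 \<or> 2 \<le> i" "j = 0 \<or> j = Suc 0 \<or> 2 \<le> j" by arith+
  then show "mat_sum (cmv_block 0) (1\<^sub>m m) $$ (i, j) = swaprows_mat (Suc (Suc m)) 0 1 $$ (i, j)"
    using ij by (elim disjE) (simp_all add: mat_sum_def d, simp_all add: cmv_block_def, arith)
qed (simp_all add: carrier_matD[OF cmv_block_carrier])

text \<open>Multiplication by \<open>S\<close> swaps two rows from the left and two columns from the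
  right. Here \<open>transpose 0 1\<close> is the transposition of the indices 0 and 1, not a
  transposed matrix.\<close>

lemma swap_conjugate:
  assumes "A \<in> carrier_mat (Suc (Suc m)) (Suc (Suc m))"
  defines "S \<equiv> mat_sum (cmv_block 0) (1\<^sub>m m)"
  shows "S * A * S \<in> carrier_mat (Suc (Suc m)) (Suc (Suc m))"
    "i < Suc (Suc m) \<Longrightarrow> j < Suc (Suc m) \<Longrightarrow>
      (S * A * S) $$ (i, j) = A $$ (transpose 0 1 i, transpose 0 1 j)"
proof -
  have "S * A = swaprows 0 1 A"
    unfolding S_def cmv_block_0_swap by (rule swaprows_mat[symmetric, OF assms(1)]) simp_all
  moreover have "swaprows 0 1 A * S = swapcols 0 1 (swaprows 0 1 A)"
    unfolding S_def cmv_block_0_swap using assms(1)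
    by (intro swapcols_mat[symmetric, where nr = "Suc (Suc m)"]) simp_all
  ultimately have eq: "S * A * S = swapcols 0 1 (swaprows 0 1 A)" by simp
  show "S * A * S \<in> carrier_mat (Suc (Suc m)) (Suc (Suc m))"
    unfolding eq using assms(1) by simp
  show "(S * A * S) $$ (i, j) = A $$ (transpose 0 1 i, transpose 0 1 j)"
    if "i < Suc (Suc m)" "j < Suc (Suc m)"
    unfolding eq using that carrier_matD[OF assms(1)] by (simp add: transpose_def)
qed

lemma swap_unitary: "mat_sum (cmv_block 0) (1\<^sub>m m) \<in> carrier (unitary_group (Suc (Suc m)))"
proof -
  have "1\<^sub>m m \<in> carrier (unitary_group m)"
    using subgroup.one_closed[OF unitary_subgroup, of m] by (simp add: one_GL)
  from unitary_mat_sum[OF unitary_cmv_block[of 0] this] show ?thesis by simp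
qed

section \<open>Peeling off one block\<close>

lemma cmv_step_GL:
  assumes "cmod z \<le> 1" "X \<in> carrier (GL (Suc m))"
  shows "mat_sum (cmv_block z) (1\<^sub>m m) \<in> carrier (unitary_group (Suc (Suc m)))"
    "mat_sum (1\<^sub>m 1) X \<in> carrier (GL (Suc (Suc m)))"
    "cmv_step m z X \<in> carrier (GL (Suc (Suc m)))"
proof -
  have "1\<^sub>m m \<in> carrier (unitary_group m)"
    using subgroup.one_closed[OF unitary_subgroup, of m] by (simp add: one_GL)
  from unitary_mat_sum[OF unitary_cmv_block[OF assms(1)] this]
  show V: "mat_sum (cmv_block z) (1\<^sub>m m) \<in> carrier (unitary_group (Suc (Suc m)))" by simp
  show X: "mat_sum (1\<^sub>m 1) X \<in> carrier (GL (Suc (Suc m)))" using assms(2) by (rule GL_mat_sum_one)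
  show "cmv_step m z X \<in> carrier (GL (Suc (Suc m)))"
    unfolding cmv_step_def using unitary_GL(1)[OF V] X by (rule GL_simps(1))
qed

lemma swap_inverse:
  "inv\<^bsub>GL (Suc (Suc m))\<^esub> (mat_sum (cmv_block 0) (1\<^sub>m m)) = mat_sum (cmv_block 0) (1\<^sub>m m)"
  unfolding cmv_block_0_swap
  by (rule right_inverse_GL(2)) (simp_all add: swaprows_mat_inv)

text \<open>A Bruhat factorization of \<Xi>(z) through the swap. With \<rho> the off-diagonal entry,
  \<open>l\<close> has rows (\<rho>, 0) and (-z, 1/\<rho>), and \<open>v\<close> is the conjugate of
  z divided by \<rho>. The lower left entry comes out right because 1 - |z|^2 is the square of
  \<rho>; |z| < 1 makes \<rho> positive.\<close>

lemma cmv_block_factorization: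
  assumes "cmod z < 1"
  obtains l v where "l \<in> carrier (lower_group 2)" "mat_of_rows_list 2 [[1, 0], [v, 1]] \<in> carrier (lower_group 2)"
    "cmv_block z = l * cmv_block 0 * mat_of_rows_list 2 [[1, 0], [v, 1]]"
proof -
  have "(cmod z)\<^sup>2 < 1" using assms by (simp add: power_less_one_iff)
  then have pos: "0 < sqrt (1 - (cmod z)\<^sup>2)" by simp
  define r where "r = complex_of_real (sqrt (1 - (cmod z)\<^sup>2))"
  have r0: "r \<noteq> 0" "0 < r" using pos by (simp_all add: r_def less_complex_def)
  have "1 / r = of_real (1 / sqrt (1 - (cmod z)\<^sup>2))" by (simp add: r_def)
  with pos have r1: "0 < 1 / r" using complex_pos_iff[of "1 / r"] by (metis zero_less_divide_1_iff)
  have rr: "r * r = 1 - z * cnj z" using cmv_rho_square[of z] assms by (simp add: r_def)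
  define v where "v = cnj z / r"
  define l where "l = mat_of_rows_list 2 [[r, 0], [- z, 1 / r]]"
  have low: "mat_of_rows_list 2 [[a, 0], [b, c]] \<in> carrier (lower_group 2)" if "0 < a" "0 < c" for a b c
    using that by (simp add: lower_iff less_2_cases_iff)
  show thesis
  proof (rule that)
    show "l \<in> carrier (lower_group 2)" unfolding l_def using r0(2) r1 by (rule low)
    show "mat_of_rows_list 2 [[1, 0], [v, 1]] \<in> carrier (lower_group 2)"
      by (intro low) (simp_all add: less_complex_def)
    have "- z * (cnj z / r) + 1 / r = r"
      using r0 rr by (simp add: field_simps)
    then show "cmv_block z = l * cmv_block 0 * mat_of_rows_list 2 [[1, 0], [v, 1]]"
      using r0 by (simp add: cmv_block_def l_def v_def mat2_mult flip: r_def)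
  qed
qed

text \<open>In the factorization of \<Xi>(z) the left triangular factor already stands outside. The
  right one differs from the identity only in the first column, by a vector \<open>c\<close> below
  the corner. Moving it past 1 \<oplus> X replaces \<open>c\<close> by the inverse of
  \<open>X\<close> applied to \<open>c\<close>, and the result \<open>?P\<close> is still lower
  triangular with unit diagonal.\<close>

lemma cmv_step_equiv_0:
  assumes z: "cmod z < 1" and X: "X \<in> carrier (GL (Suc m))"
  shows "lower_equiv (Suc (Suc m)) (cmv_step m 0 X) (cmv_step m z X)"
proof -
  obtain l v where l: "l \<in> carrier (lower_group 2)"
    and v: "mat_of_rows_list 2 [[1, 0], [v, 1]] \<in> carrier (lower_group 2)"
    and eq: "cmv_block z = l * cmv_block 0 * mat_of_rows_list 2 [[1, 0], [v, 1]]"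
    using cmv_block_factorization[OF z] by metis
  let ?v = "mat_of_rows_list 2 [[1, 0], [v, 1]]"
  have Xc: "X \<in> carrier_mat (Suc m) (Suc m)" using X by (simp add: carrier_GL)
  define X' where "X' = inv\<^bsub>GL (Suc m)\<^esub> X"
  have X'c: "X' \<in> carrier_mat (Suc m) (Suc m)" using X unfolding X'_def by (rule inv_GL_carrier_mat)
  have XX': "X * X' = 1\<^sub>m (Suc m)" using X by (simp add: X'_def)
  \<comment> \<open>The first column of the right factor below its corner, after the factor is
    enlarged by an identity.\<close>
  define c where "c = mat (Suc m) 1 (\<lambda>(i, _). if i = 0 then v else 0)"
  have cc: "c \<in> carrier_mat (Suc m) 1" by (simp add: c_def)
  note X'cc = mult_carrier_mat[OF X'c cc]
  let ?P = "four_block_mat (1\<^sub>m 1) (0\<^sub>m 1 (Suc m)) (X' * c) (1\<^sub>m (Suc m))"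
  let ?X = "four_block_mat (1\<^sub>m 1) (0\<^sub>m 1 (Suc m)) (0\<^sub>m (Suc m) 1) X"
  let ?C = "four_block_mat (1\<^sub>m 1) (0\<^sub>m 1 (Suc m)) c (1\<^sub>m (Suc m))"
  have Xs: "mat_sum (1\<^sub>m 1) X = ?X" using carrier_matD[OF Xc] by (simp add: mat_sum_def)
  have "?C * ?X = four_block_mat (1\<^sub>m 1 * 1\<^sub>m 1 + 0\<^sub>m 1 (Suc m) * 0\<^sub>m (Suc m) 1) (1\<^sub>m 1 * 0\<^sub>m 1 (Suc m) + 0\<^sub>m 1 (Suc m) * X)
      (c * 1\<^sub>m 1 + 1\<^sub>m (Suc m) * 0\<^sub>m (Suc m) 1) (c * 0\<^sub>m 1 (Suc m) + 1\<^sub>m (Suc m) * X)"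
    by (rule mult_four_block_mat[OF one_carrier_mat zero_carrier_mat cc one_carrier_mat
      one_carrier_mat zero_carrier_mat zero_carrier_mat Xc])
  also have "\<dots> = four_block_mat (1\<^sub>m 1 * 1\<^sub>m 1 + 0\<^sub>m 1 (Suc m) * (X' * c)) (1\<^sub>m 1 * 0\<^sub>m 1 (Suc m) + 0\<^sub>m 1 (Suc m) * 1\<^sub>m (Suc m))
      (0\<^sub>m (Suc m) 1 * 1\<^sub>m 1 + X * (X' * c)) (0\<^sub>m (Suc m) 1 * 0\<^sub>m 1 (Suc m) + X * 1\<^sub>m (Suc m))"
  proof (rule cong_four_block_mat)
    \<comment> \<open>This makes the lower left blocks agree, the only place where the two products
      differ visibly.\<close>
    have Xc': "X * (X' * c) = c"
      using assoc_mult_mat[OF Xc X'c cc] XX' left_mult_one_mat[OF cc] by simp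
    show "1\<^sub>m 1 * 1\<^sub>m 1 + 0\<^sub>m 1 (Suc m) * 0\<^sub>m (Suc m) 1 = 1\<^sub>m 1 * 1\<^sub>m 1 + 0\<^sub>m 1 (Suc m) * (X' * c)"
      using left_mult_zero_mat[OF X'cc, of 1] left_mult_zero_mat[OF zero_carrier_mat[of "Suc m" 1], of 1] by simp
    show "1\<^sub>m 1 * 0\<^sub>m 1 (Suc m) + 0\<^sub>m 1 (Suc m) * X = 1\<^sub>m 1 * 0\<^sub>m 1 (Suc m) + 0\<^sub>m 1 (Suc m) * 1\<^sub>m (Suc m)"
      using left_mult_zero_mat[OF Xc, of 1] left_mult_zero_mat[OF one_carrier_mat[of "Suc m"], of 1] by simp
    show "c * 1\<^sub>m 1 + 1\<^sub>m (Suc m) * 0\<^sub>m (Suc m) 1 = 0\<^sub>m (Suc m) 1 * 1\<^sub>m 1 + X * (X' * c)"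
      unfolding Xc' using right_mult_one_mat[OF cc] right_add_zero_mat[OF cc] left_add_zero_mat[OF cc] by simp
    show "c * 0\<^sub>m 1 (Suc m) + 1\<^sub>m (Suc m) * X = 0\<^sub>m (Suc m) 1 * 0\<^sub>m 1 (Suc m) + X * 1\<^sub>m (Suc m)"
      using right_mult_zero_mat[OF cc, of "Suc m"] left_mult_zero_mat[OF zero_carrier_mat[of 1 "Suc m"], of "Suc m"]
        left_mult_one_mat[OF Xc] right_mult_one_mat[OF Xc] by simp
  qed
  also have "\<dots> = ?X * ?P"
    by (rule mult_four_block_mat[symmetric, OF one_carrier_mat zero_carrier_mat zero_carrier_mat Xc
      one_carrier_mat zero_carrier_mat X'cc one_carrier_mat])
  finally have comm: "?C * ?X = ?X * ?P" .
  have vC: "mat_sum ?v (1\<^sub>m m) = ?C"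
  proof (rule eq_matI)
    fix i j assume "i < dim_row ?C" "j < dim_col ?C"
    then have ij: "i < Suc (Suc m)" "j < Suc (Suc m)" by simp_all
    note d = carrier_matD[OF mat2_simps(1)]
    have "i = 0 \<or> i = Suc 0 \<or> 2 \<le> i" "j = 0 \<or> j = Suc 0 \<or> 2 \<le> j" by arith+
    then show "mat_sum ?v (1\<^sub>m m) $$ (i, j) = ?C $$ (i, j)"
      using ij by (elim disjE) (simp_all add: mat_sum_def d c_def, arith+)
  qed (simp_all add: carrier_matD[OF mat2_simps(1)])
  have P: "?P \<in> carrier (lower_group (Suc (Suc m)))"
    using carrier_matD[OF X'cc] by (auto simp: lower_iff less_complex_def)
  have l1: "mat_sum l (1\<^sub>m m) \<in> carrier (lower_group (Suc (Suc m)))"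
    using lower_mat_sum[OF l one_lower[of m]] by simp
  have l2: "mat_sum ?v (1\<^sub>m m) \<in> carrier (lower_group (Suc (Suc m)))"
    using lower_mat_sum[OF v one_lower[of m]] by simp
  have lc: "l \<in> carrier_mat 2 2" using l by (simp add: lower_iff)
  have "mat_sum (cmv_block z) (1\<^sub>m m) = mat_sum l (1\<^sub>m m) * mat_sum (cmv_block 0) (1\<^sub>m m) * mat_sum ?v (1\<^sub>m m)"
    using mat_sum_mult[OF lc cmv_block_carrier[of 0] one_carrier_mat[of m] one_carrier_mat[of m]]
      mat_sum_mult[OF mult_carrier_mat[OF lc cmv_block_carrier[of 0]] mat2_simps(1)[of 1 0 v 1] one_carrier_mat[of m] one_carrier_mat[of m]]
    by (simp add: eq)
  then have "cmv_step m z X = mat_sum l (1\<^sub>m m) * mat_sum (cmv_block 0) (1\<^sub>m m) * mat_sum ?v (1\<^sub>m m) * mat_sum (1\<^sub>m 1) X"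
    by (simp only: cmv_step_def)
  also have "\<dots> = mat_sum l (1\<^sub>m m) * (mat_sum (cmv_block 0) (1\<^sub>m m) * (mat_sum ?v (1\<^sub>m m) * mat_sum (1\<^sub>m 1) X))"
    using lower_GL[OF l1] lower_GL[OF l2] unitary_GL(1)[OF cmv_step_GL(1)[OF _ X, of 0]] cmv_step_GL(2)[OF _ X, of 0]
    by (simp add: GL_assoc[where n = "Suc (Suc m)"] del: One_nat_def)
  also have "mat_sum ?v (1\<^sub>m m) * mat_sum (1\<^sub>m 1) X = mat_sum (1\<^sub>m 1) X * ?P"
    using comm by (simp only: vC Xs)
  also have "mat_sum l (1\<^sub>m m) * (mat_sum (cmv_block 0) (1\<^sub>m m) * (mat_sum (1\<^sub>m 1) X * ?P)) =
      mat_sum l (1\<^sub>m m) * cmv_step m 0 X * ?P"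
    unfolding cmv_step_def
    using lower_GL[OF l1] lower_GL[OF P] unitary_GL(1)[OF cmv_step_GL(1)[OF _ X, of 0]] cmv_step_GL(2)[OF _ X, of 0]
    by (simp add: GL_assoc[where n = "Suc (Suc m)"] del: One_nat_def)
  finally show ?thesis by (rule lower_equivI[OF l1 P])
qed

text \<open>With \<open>S\<close> the swap, 1 \<oplus> l is carried to the left of \<open>S\<close>
  by inserting \<open>S * S\<close>. This yields the conjugate of 1 \<oplus> l by \<open>S\<close>,
  which is still lower triangular.\<close>

lemma cmv_step_0_equivI:
  assumes XY: "lower_equiv (Suc m) X Y" and X: "X \<in> carrier (GL (Suc m))" and Y: "Y \<in> carrier (GL (Suc m))"
  shows "lower_equiv (Suc (Suc m)) (cmv_step m 0 X) (cmv_step m 0 Y)"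
proof -
  let ?G = "carrier (GL (Suc (Suc m)))"
  obtain l p where l: "l \<in> carrier (lower_group (Suc m))" and p: "p \<in> carrier (lower_group (Suc m))" and eq: "Y = l * X * p"
    using XY by (elim lower_equivE)
  define S where "S = mat_sum (cmv_block 0) (1\<^sub>m m)"
  define l1 where "l1 = mat_sum (1\<^sub>m 1) l"
  define p1 where "p1 = mat_sum (1\<^sub>m 1) p"
  define X1 where "X1 = mat_sum (1\<^sub>m 1) X"
  have lL: "l1 \<in> carrier (lower_group (Suc (Suc m)))" and pL: "p1 \<in> carrier (lower_group (Suc (Suc m)))"
    using lower_mat_sum[OF one_lower[of 1] l] lower_mat_sum[OF one_lower[of 1] p] by (simp_all add: l1_def p1_def)
  have c: "l \<in> carrier_mat (Suc m) (Suc m)" "X \<in> carrier_mat (Suc m) (Suc m)" "p \<in> carrier_mat (Suc m) (Suc m)"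
    using l p X by (simp_all add: lower_iff carrier_GL)
  have Y1: "mat_sum (1\<^sub>m 1) Y = l1 * X1 * p1"
    using mat_sum_mult[OF one_carrier_mat[of 1] one_carrier_mat[of 1] c(1,2)]
      mat_sum_mult[OF one_carrier_mat[of 1] one_carrier_mat[of 1] mult_carrier_mat[OF c(1,2)] c(3)]
    by (simp add: eq l1_def X1_def p1_def)
  have S: "S \<in> ?G" "inv\<^bsub>GL (Suc (Suc m))\<^esub> S = S"
    using swap_inverse unitary_GL(1)[OF swap_unitary] S_def by auto
  have G: "l1 \<in> ?G" "p1 \<in> ?G" "X1 \<in> ?G"
    using lower_GL[OF lL] lower_GL[OF pL] GL_mat_sum_one[OF X] by (simp_all add: X1_def)
  have SS: "S * S = 1\<^sub>m (Suc (Suc m))" using GL_simps(6)[OF S(1)] S(2) by simp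
  have "S * (l1 * X1 * p1) = S * l1 * (S * S) * X1 * p1"
    unfolding SS using S G by (simp add: GL_assoc[where n = "Suc (Suc m)"])
  also have "\<dots> = (S * l1 * S) * (S * X1) * p1"
    using S G by (simp add: GL_assoc[where n = "Suc (Suc m)"])
  finally have "cmv_step m 0 Y = (S * l1 * S) * cmv_step m 0 X * p1"
    using Y1 by (simp add: cmv_step_def S_def X1_def)
  moreover have "S * l1 * S \<in> carrier (lower_group (Suc (Suc m)))"
  proof -
    have l1c: "l1 \<in> carrier_mat (Suc (Suc m)) (Suc (Suc m))" using lL by (simp add: lower_iff)
    note sc = swap_conjugate[OF l1c, folded S_def]
    have l10: "l1 $$ (0, j) = 0" if "0 < j" "j < Suc (Suc m)" for j
      using lL that by (simp add: lower_iff)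
    \<comment> \<open>Conjugation moves this entry to position (0, 1). All other entries above the
      diagonal of the conjugate come from above the diagonal of \<open>l1\<close>.\<close>
    have l101: "l1 $$ (Suc 0, 0) = 0"
      using mat_sum_one_index(3)[OF c(1), of 0] by (simp add: l1_def)
    have "(S * l1 * S) $$ (i, j) = 0" if ij: "i < Suc (Suc m)" "j < Suc (Suc m)" "i < j" for i j
    proof -
      consider "i = 0" "j = Suc 0" | "i = 0" "2 \<le> j" | "i = 1" "2 \<le> j" | "2 \<le> i" using ij(3) by linarith
      then show ?thesis
        using ij lL l101 by cases (simp_all add: sc(2) transpose_def lower_iff)
    qed
    moreover have "0 < (S * l1 * S) $$ (i, i)" if i: "i < Suc (Suc m)" for i
    proof -
      have "transpose 0 1 i < Suc (Suc m)" using i by (simp add: transpose_def)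
      then show ?thesis using lL i by (simp add: sc(2) lower_iff del: One_nat_def)
    qed
    ultimately show ?thesis using sc(1) by (simp add: lower_iff)
  qed
  ultimately show ?thesis using pL by (intro lower_equivI)
qed

text \<open>Moving the swap to the left and \<open>p\<close> to the other side gives an equation
  between 1 \<oplus> Y times \<open>q\<close> and the conjugate of \<open>l\<close> times 1 \<oplus>
  X. The conjugate can fail to be lower triangular only at (0, 1), so compression to the remaining
  coordinates leaves triangular factors.\<close>

lemma cmv_step_0_equivD:
  assumes XY: "lower_equiv (Suc (Suc m)) (cmv_step m 0 X) (cmv_step m 0 Y)"
    and X: "X \<in> carrier (GL (Suc m))" and Y: "Y \<in> carrier (GL (Suc m))"
  shows "lower_equiv (Suc m) X Y"
proof -
  let ?G = "carrier (GL (Suc (Suc m)))"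
  define S where "S = mat_sum (cmv_block 0) (1\<^sub>m m)"
  define X1 where "X1 = mat_sum (1\<^sub>m 1) X"
  define Y1 where "Y1 = mat_sum (1\<^sub>m 1) Y"
  obtain l p where l: "l \<in> carrier (lower_group (Suc (Suc m)))" and p: "p \<in> carrier (lower_group (Suc (Suc m)))"
    and eq: "S * Y1 = l * (S * X1) * p"
    using XY by (elim lower_equivE) (simp add: cmv_step_def S_def X1_def Y1_def)
  define q where "q = inv\<^bsub>GL (Suc (Suc m))\<^esub> p"
  have q: "q \<in> carrier (lower_group (Suc (Suc m)))" unfolding q_def using p by (intro lower_closed(2))
  have S: "S \<in> ?G" "inv\<^bsub>GL (Suc (Suc m))\<^esub> S = S"
    using swap_inverse unitary_GL(1)[OF swap_unitary] S_def by auto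
  have SS: "S * S = 1\<^sub>m (Suc (Suc m))" using GL_simps(6)[OF S(1)] S(2) by simp
  have G: "l \<in> ?G" "p \<in> ?G" "q \<in> ?G" "X1 \<in> ?G" "Y1 \<in> ?G"
    using lower_GL[OF l] lower_GL[OF p] lower_GL[OF q] GL_mat_sum_one[OF X] GL_mat_sum_one[OF Y]
    by (simp_all add: X1_def Y1_def)
  have "Y1 * q = S * (S * Y1) * q"
    using S G SS by (simp flip: GL_assoc[where n = "Suc (Suc m)"])
  also have "\<dots> = (S * l * S) * X1 * (p * q)"
    unfolding eq using S G by (simp add: GL_assoc[where n = "Suc (Suc m)"] del: GL_simps(6))
  also have "p * q = 1\<^sub>m (Suc (Suc m))" using G by (simp add: q_def)
  finally have YT: "Y1 * q = (S * l * S) * X1" using S G by simp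
  have Xc: "X \<in> carrier_mat (Suc m) (Suc m)" and Yc: "Y \<in> carrier_mat (Suc m) (Suc m)"
    using X Y by (simp_all add: carrier_GL)
  have lc: "l \<in> carrier_mat (Suc (Suc m)) (Suc (Suc m))" and qc: "q \<in> carrier_mat (Suc (Suc m)) (Suc (Suc m))"
    using l q by (simp_all add: lower_iff)
  note sc = swap_conjugate[OF lc, folded S_def]
  define q' where "q' = lower_right q"
  have q': "q' \<in> carrier (lower_group (Suc m))" unfolding q'_def using q by (rule lower_right_lower)
  \<comment> \<open>After the swap, the deleted row and column are the second ones of
    \<open>l\<close>. So \<open>T\<close> is a principal submatrix of \<open>l\<close> and inherits
    triangularity and the positive diagonal.\<close>
  define T where "T = lower_right (S * l * S)"
  have YT': "Y * q' = T * X"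
    using YT lower_right_mult_left[OF Yc qc] lower_right_mult_right[OF sc(1) Xc]
    by (simp add: q'_def T_def X1_def Y1_def)
  have T: "T \<in> carrier (lower_group (Suc m))"
  proof -
    have "T $$ (i, j) = 0" if ij: "i < Suc m" "j < Suc m" "i < j" for i j
    proof -
      have "T $$ (i, j) = l $$ (transpose 0 1 (Suc i), transpose 0 1 (Suc j))"
        unfolding T_def using index_lower_right[OF sc(1) ij(1,2)] ij by (simp add: sc(2))
      moreover have "transpose 0 1 (Suc i) < Suc j" "transpose 0 1 (Suc j) = Suc j"
        using ij by (auto simp: transpose_def)
      ultimately show ?thesis using l ij by (simp add: lower_iff)
    qed
    moreover have "0 < T $$ (i, i)" if i: "i < Suc m" for i
    proof -
      have "T $$ (i, i) = l $$ (transpose 0 1 (Suc i), transpose 0 1 (Suc i))"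
        unfolding T_def using index_lower_right[OF sc(1) i i] i by (simp add: sc(2))
      moreover have "transpose 0 1 (Suc i) < Suc (Suc m)" using i by (simp add: transpose_def)
      ultimately show ?thesis using l by (simp add: lower_iff)
    qed
    ultimately show ?thesis unfolding lower_iff using lower_right_carrier[OF sc(1)] by (simp add: T_def)
  qed
  have "Y = Y * q' * inv\<^bsub>GL (Suc m)\<^esub> q'"
    using Y lower_GL[OF q'] by (simp add: GL_assoc[where n = "Suc m"])
  also have "\<dots> = T * X * inv\<^bsub>GL (Suc m)\<^esub> q'" unfolding YT' ..
  finally show ?thesis using T lower_closed(2)[OF q' q'] by (intro lower_equivI)
qed

text \<open>Both coefficients can be moved to 0 without leaving the equivalence class, and for 0 the
  two directions are already known.\<close>

lemma cmv_step_equiv_iff: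
  assumes z: "cmod z < 1" and w: "cmod w < 1"
    and X: "X \<in> carrier (GL (Suc m))" and Y: "Y \<in> carrier (GL (Suc m))"
  shows "lower_equiv (Suc (Suc m)) (cmv_step m z X) (cmv_step m w Y) \<longleftrightarrow> lower_equiv (Suc m) X Y"
proof -
  note X0 = cmv_step_equiv_0[OF z X] and Y0 = cmv_step_equiv_0[OF w Y]
  have GX: "cmv_step m 0 X \<in> carrier (GL (Suc (Suc m)))" using cmv_step_GL(3)[OF _ X, of 0] by simp
  have GY: "cmv_step m 0 Y \<in> carrier (GL (Suc (Suc m)))" using cmv_step_GL(3)[OF _ Y, of 0] by simp
  have Gz: "cmv_step m z X \<in> carrier (GL (Suc (Suc m)))" using cmv_step_GL(3)[OF _ X, of z] z by simp
  have Gw: "cmv_step m w Y \<in> carrier (GL (Suc (Suc m)))" using cmv_step_GL(3)[OF _ Y, of w] w by simp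
  show ?thesis
  proof
    assume "lower_equiv (Suc (Suc m)) (cmv_step m z X) (cmv_step m w Y)"
    with X0 GX have "lower_equiv (Suc (Suc m)) (cmv_step m 0 X) (cmv_step m w Y)"
      by (blast intro: lower_equiv_trans)
    with lower_equiv_sym[OF Y0 GY] GX have "lower_equiv (Suc (Suc m)) (cmv_step m 0 X) (cmv_step m 0 Y)"
      by (blast intro: lower_equiv_trans)
    then show "lower_equiv (Suc m) X Y" using X Y by (rule cmv_step_0_equivD)
  next
    assume "lower_equiv (Suc m) X Y"
    then have "lower_equiv (Suc (Suc m)) (cmv_step m 0 X) (cmv_step m 0 Y)"
      using X Y by (rule cmv_step_0_equivI)
    with lower_equiv_sym[OF X0 GX] Gz have "lower_equiv (Suc (Suc m)) (cmv_step m z X) (cmv_step m 0 Y)"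
      by (blast intro: lower_equiv_trans)
    with Y0 Gz show "lower_equiv (Suc (Suc m)) (cmv_step m z X) (cmv_step m w Y)"
      by (blast intro: lower_equiv_trans)
  qed
qed

section \<open>CMV matrices up to triangular equivalence\<close>

lemma cmv_step_unitary:
  assumes "cmod z \<le> 1" "X \<in> carrier (unitary_group (Suc m))"
  shows "cmv_step m z X \<in> carrier (unitary_group (Suc (Suc m)))"
proof -
  have "mat_sum (1\<^sub>m 1) X \<in> carrier (unitary_group (Suc (Suc m)))"
    using assms(2) unitary_mat_sum_one_iff[of X "Suc m"] by (simp add: unitary_iff)
  then show ?thesis
    unfolding cmv_step_def
    using cmv_step_GL(1)[OF assms(1) unitary_GL(1)[OF assms(2)]] by (intro unitary_closed(1))
qed

text \<open>All \<Xi>(z) in the disk are unitary and equivalent to the swap, so they share its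
  determinant and no value has to be computed.\<close>

lemma det_cmv_step:
  assumes "cmod z < 1" "X \<in> carrier_mat (Suc m) (Suc m)"
  shows "det (cmv_step m z X) = det (cmv_block 0) * det X"
proof -
  obtain l v where l: "l \<in> carrier (lower_group 2)" "mat_of_rows_list 2 [[1, 0], [v, 1]] \<in> carrier (lower_group 2)"
    "cmv_block z = l * cmv_block 0 * mat_of_rows_list 2 [[1, 0], [v, 1]]"
    using cmv_block_factorization[OF assms(1)] by metis
  have "lower_equiv 2 (cmv_block 0) (cmv_block z)" using l by (rule lower_equivI)
  then have eq: "det (cmv_block 0) = det (cmv_block z)"
    using unitary_cmv_block[of 0] unitary_cmv_block[of z] assms(1) by (intro lower_equiv_det) simp_all
  have c: "mat_sum (cmv_block z) (1\<^sub>m m) \<in> carrier_mat (Suc (Suc m)) (Suc (Suc m))"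
    using mat_sum_carrier[OF cmv_block_carrier[of z] one_carrier_mat[of m]] by simp
  show ?thesis
    unfolding cmv_step_def eq det_mult[OF c mat_sum_one_carrier[OF assms(2)]]
      det_mat_sum[OF cmv_block_carrier one_carrier_mat] det_mat_sum[OF one_carrier_mat assms(2)]
    by simp
qed

text \<open>\<open>m\<close> is the index of the last coefficient, so the matrix has size m + 1.
  This indexing suits an induction that removes the first coefficient.\<close>

definition cmv_coeffs :: "nat \<Rightarrow> (nat \<Rightarrow> complex) \<Rightarrow> bool" where
  "cmv_coeffs m a \<longleftrightarrow> (\<forall>k<m. cmod (a k) < 1) \<and> cmod (a m) = 1"

lemma cmv_coeffs_Suc: "cmv_coeffs (Suc m) a \<longleftrightarrow> cmod (a 0) < 1 \<and> cmv_coeffs m (a \<circ> Suc)"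
  by (auto simp: cmv_coeffs_def All_less_Suc2)

lemma cmv_matrices_Suc: "cmv_matrices (Suc m) = cmv_matrix (Suc m) ` {a. cmv_coeffs m a}"
  by (auto simp: cmv_matrices_def cmv_coeffs_def)

lemma cmv_matrix_unitary: "cmv_coeffs m a \<Longrightarrow> cmv_matrix (Suc m) a \<in> carrier (unitary_group (Suc m))"
proof (induction m arbitrary: a)
  case 0
  then have "a 0 * cnj (a 0) = 1" using complex_norm_square[of "a 0"] by (simp add: cmv_coeffs_def)
  then have "cmv_matrix (Suc 0) a * mat_adjoint (cmv_matrix (Suc 0) a) = 1\<^sub>m (Suc 0)"
    unfolding cmv_matrix_1
    by (intro eq_matI) (simp_all add: scalar_prod_def index_mat_adjoint[of _ 1] mult.commute)
  then show ?case using cmv_matrix_carrier[of 0 a] by (simp add: unitary_iff)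
next
  case (Suc m)
  then have "cmv_coeffs m (a \<circ> Suc)" by (simp add: cmv_coeffs_Suc)
  then have "transpose_mat (cmv_matrix (Suc m) (a \<circ> Suc)) \<in> carrier (unitary_group (Suc m))"
    by (rule unitary_transpose[OF Suc.IH])
  then show ?case
    unfolding cmv_matrix_Suc_Suc using Suc.prems by (intro cmv_step_unitary) (simp_all add: cmv_coeffs_Suc)
qed

text \<open>Peeling off the first block preserves equality of determinants, because the block
  determinants agree and are nonzero. The induction hypothesis is transposed to match the recursion.
  In size 1 the determinant is the only entry.\<close>

lemma cmv_matrix_equiv:
  assumes "cmv_coeffs m a" "cmv_coeffs m b" "det (cmv_matrix (Suc m) a) = det (cmv_matrix (Suc m) b)"
  shows "lower_equiv (Suc m) (cmv_matrix (Suc m) a) (cmv_matrix (Suc m) b)"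
  using assms
proof (induction m arbitrary: a b)
  case 0
  then have "cmv_matrix (Suc 0) a = cmv_matrix (Suc 0) b"
    unfolding cmv_matrix_1 by (simp add: det_single)
  then have "cmv_matrix (Suc 0) b = 1\<^sub>m (Suc 0) * cmv_matrix (Suc 0) a * 1\<^sub>m (Suc 0)"
    using left_mult_one_mat[OF cmv_matrix_carrier[of 0 b]] right_mult_one_mat[OF cmv_matrix_carrier[of 0 b]] by simp
  then show ?case by (intro lower_equivI[OF one_lower one_lower])
next
  case (Suc m)
  define A where "A = cmv_matrix (Suc m) (a \<circ> Suc)"
  define B where "B = cmv_matrix (Suc m) (b \<circ> Suc)"
  have ab: "cmod (a 0) < 1" "cmv_coeffs m (a \<circ> Suc)" "cmod (b 0) < 1" "cmv_coeffs m (b \<circ> Suc)"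
    using Suc.prems by (simp_all add: cmv_coeffs_Suc)
  have Ac: "A \<in> carrier_mat (Suc m) (Suc m)" and Bc: "B \<in> carrier_mat (Suc m) (Suc m)"
    by (simp_all only: A_def B_def cmv_matrix_carrier)
  have U: "A \<in> carrier (unitary_group (Suc m))" "B \<in> carrier (unitary_group (Suc m))"
    using ab cmv_matrix_unitary by (simp_all add: A_def B_def)
  have "det (cmv_block 0) * det A = det (cmv_block 0) * det B"
    using Suc.prems(3) det_cmv_step[OF ab(1), of "transpose_mat A" m] det_cmv_step[OF ab(3), of "transpose_mat B" m] Ac Bc
    by (simp add: cmv_matrix_Suc_Suc det_transpose[OF Ac] det_transpose[OF Bc] flip: A_def B_def)
  moreover have "det (cmv_block 0) \<noteq> 0"
    using unitary_GL(1)[OF unitary_cmv_block[of 0]] by (simp add: carrier_GL)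
  ultimately have "det A = det B" by simp
  then have "lower_equiv (Suc m) A B"
    unfolding A_def B_def by (rule Suc.IH[OF ab(2,4)])
  then have "lower_equiv (Suc m) (transpose_mat A) (transpose_mat B)"
    using U by (rule lower_equiv_transpose)
  then show ?case
    unfolding cmv_matrix_Suc_Suc A_def[symmetric] B_def[symmetric]
    using cmv_step_equiv_iff[OF ab(1,3) unitary_GL(1)[OF unitary_transpose[OF U(1)]] unitary_GL(1)[OF unitary_transpose[OF U(2)]]]
    by simp
qed

section \<open>Unitary matrices equivalent to a CMV matrix\<close>

text \<open>The first column is the first basis vector, and orthogonality of the other columns to it
  clears the rest of the first row.\<close>

lemma unitary_first_column:
  assumes M: "M \<in> carrier (unitary_group (Suc m))"
    and col: "M $$ (0, 0) = 1" "\<And>i. i < m \<Longrightarrow> M $$ (Suc i, 0) = 0"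
  shows "M = mat_sum (1\<^sub>m 1) (lower_right M)"
proof -
  have c: "M \<in> carrier_mat (Suc m) (Suc m)" using M by (simp add: unitary_iff)
  note M' = mat_adjoint_carrier[OF c]
  have row: "M $$ (0, Suc j) = 0" if j: "j < m" for j
  proof -
    have "0 = (mat_adjoint M * M) $$ (0, Suc j)" using M j by (simp add: unitary_group_def)
    also have "\<dots> = (\<Sum>t<Suc m. mat_adjoint M $$ (0, t) * M $$ (t, Suc j))"
      using j by (intro index_mult_mat_sum[OF M' c]) simp_all
    also have "\<dots> = M $$ (0, Suc j)"
      using j by (simp add: sum.lessThan_Suc_shift index_mat_adjoint[OF c] col del: sum.lessThan_Suc)
    finally show ?thesis by simp
  qed
  note d = mat_sum_one_index[OF lower_right_carrier[OF c]]
  show ?thesis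
  proof (rule eq_matI)
    fix i j assume "i < dim_row (mat_sum (1\<^sub>m 1) (lower_right M))" "j < dim_col (mat_sum (1\<^sub>m 1) (lower_right M))"
    then have "i < Suc m" "j < Suc m" using carrier_matD[OF lower_right_carrier[OF c]] by simp_all
    then show "M $$ (i, j) = mat_sum (1\<^sub>m 1) (lower_right M) $$ (i, j)"
      using col row by (cases i; cases j) (simp_all add: d index_lower_right[OF c])
  qed (use carrier_matD[OF lower_right_carrier[OF c]] carrier_matD[OF c] in simp_all)
qed

text \<open>The factor 1 \<oplus> X fixes the first basis vector, so the first column does not
  depend on \<open>X\<close>.\<close>

lemma cmv_step_first_column:
  assumes "X \<in> carrier_mat (Suc m) (Suc m)" "i < Suc (Suc m)"
  shows "cmv_step m z X $$ (i, 0) = mat_sum (cmv_block z) (1\<^sub>m m) $$ (i, 0)"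
proof -
  have c: "mat_sum (cmv_block z) (1\<^sub>m m) \<in> carrier_mat (Suc (Suc m)) (Suc (Suc m))"
    using mat_sum_carrier[OF cmv_block_carrier[of z] one_carrier_mat[of m]] by simp
  have "cmv_step m z X $$ (i, 0) = (\<Sum>t<Suc (Suc m). mat_sum (cmv_block z) (1\<^sub>m m) $$ (i, t) * mat_sum (1\<^sub>m 1) X $$ (t, 0))"
    unfolding cmv_step_def using assms(2) by (intro index_mult_mat_sum[OF c mat_sum_one_carrier[OF assms(1)]]) simp_all
  also have "\<dots> = mat_sum (cmv_block z) (1\<^sub>m m) $$ (i, 0)"
    by (subst sum.lessThan_Suc_shift) (simp add: mat_sum_one_index[OF assms(1)] del: sum.lessThan_Suc)
  finally show ?thesis .
qed

lemma cmv_block_sum_first_column: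
  "mat_sum (cmv_block z) (1\<^sub>m m) $$ (0, 0) = cnj z"
  "mat_sum (cmv_block z) (1\<^sub>m m) $$ (Suc 0, 0) = of_real (sqrt (1 - (cmod z)\<^sup>2))"
  "i < m \<Longrightarrow> mat_sum (cmv_block z) (1\<^sub>m m) $$ (Suc (Suc i), 0) = 0"
  using carrier_matD[OF cmv_block_carrier[of z]] by (simp_all add: mat_sum_def, simp_all add: cmv_block_def)

text \<open>The first column of \<open>D\<close> has the shape of that of \<Xi>(w) \<oplus> 1: a
  positive second entry and zeros below it. Unitarity fixes the second entry in terms of the first,
  so the column is that of \<Xi>(w) \<oplus> 1 for some w in the disk. Dividing by this matrix
  leaves a unitary matrix of the form 1 \<oplus> Y.\<close>

lemma unitary_equiv_cmv_step:
  assumes z: "cmod z < 1" and X: "X \<in> carrier (unitary_group (Suc m))"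
    and D: "D \<in> carrier (unitary_group (Suc (Suc m)))"
    and eq: "lower_equiv (Suc (Suc m)) (cmv_step m z X) D"
  obtains w Y where "cmod w < 1" "Y \<in> carrier (unitary_group (Suc m))" "D = cmv_step m w Y"
proof -
  let ?n = "Suc (Suc m)"
  define E where "E = cmv_step m z X"
  have E: "E \<in> carrier (unitary_group ?n)" unfolding E_def using z X by (intro cmv_step_unitary) simp_all
  have Dc: "D \<in> carrier_mat ?n ?n" and Ec: "E \<in> carrier_mat ?n ?n" and Xc: "X \<in> carrier_mat (Suc m) (Suc m)"
    using D E X by (simp_all add: unitary_iff)
  obtain l p where l: "l \<in> carrier (lower_group ?n)" and p: "p \<in> carrier (lower_group ?n)" and Dlp: "D = l * E * p"
    using eq unfolding E_def by (elim lower_equivE)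
  define k where "k = inv\<^bsub>GL ?n\<^esub> l"
  define q where "q = inv\<^bsub>GL ?n\<^esub> p"
  have k: "k \<in> carrier (lower_group ?n)" and q: "q \<in> carrier (lower_group ?n)"
    using lower_closed(2)[OF l l] lower_closed(2)[OF p p] by (simp_all add: k_def q_def)
  \<comment> \<open>Inversion turns the first column of \<open>D\<close> into the first row of a
    product in which the left triangular factor \<open>q\<close> contributes only its corner entry.
    Multiplying \<open>l * E * p\<close> out directly would mix all columns of
    \<open>E\<close>.\<close>
  have D': "mat_adjoint D = q * (mat_adjoint E * k)"
    using Dlp lower_GL[OF l] lower_GL[OF p] unitary_GL[OF E] unitary_GL(2)[OF D]
    by (simp add: GL_inv_mult[where n = ?n] GL_assoc[where n = ?n] k_def q_def flip: unitary_GL(2)[OF E])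
  have kc: "k \<in> carrier_mat ?n ?n" using k by (simp add: lower_iff)
  note E'c = mat_adjoint_carrier[OF Ec]
  have Ecol: "E $$ (Suc 0, 0) = of_real (sqrt (1 - (cmod z)\<^sup>2))" "\<And>i. i < m \<Longrightarrow> E $$ (Suc (Suc i), 0) = 0"
    using cmv_step_first_column[OF Xc] by (simp_all add: E_def cmv_block_sum_first_column)
  have row: "cnj (D $$ (Suc j, 0)) = q $$ (0, 0) * (cnj (E $$ (Suc 0, 0)) * k $$ (Suc 0, Suc j))" if j: "j < Suc m" for j
  proof -
    have "cnj (D $$ (Suc j, 0)) = (q * (mat_adjoint E * k)) $$ (0, Suc j)"
      using index_mat_adjoint[OF Dc, of 0 "Suc j"] j by (simp flip: D')
    also have "\<dots> = q $$ (0, 0) * (mat_adjoint E * k) $$ (0, Suc j)"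
      using index_lower_mult[OF q mult_carrier_mat[OF E'c kc], of 0 "Suc j"] j by simp
    also have "(mat_adjoint E * k) $$ (0, Suc j) = (\<Sum>t<?n. mat_adjoint E $$ (0, t) * k $$ (t, Suc j))"
      using j by (intro index_mult_mat_sum[OF E'c kc]) simp_all
    also have "\<dots> = cnj (E $$ (Suc 0, 0)) * k $$ (Suc 0, Suc j)"
      using j k by (simp add: sum.lessThan_Suc_shift index_mat_adjoint[OF Ec] Ecol(2) lower_iff del: sum.lessThan_Suc)
    finally show ?thesis .
  qed
  have D0: "D $$ (Suc (Suc i), 0) = 0" if i: "i < m" for i
    using row[of "Suc i"] i k by (simp add: lower_iff)
  have rho: "0 < sqrt (1 - (cmod z)\<^sup>2)" using z by (simp add: power_less_one_iff)
  have "0 < q $$ (0, 0) * (cnj (E $$ (Suc 0, 0)) * k $$ (Suc 0, Suc 0))"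
    using q k rho by (intro complex_mult_pos) (simp_all add: lower_iff Ecol(1) less_complex_def)
  then have "0 < cnj (D $$ (Suc 0, 0))" using row[of 0] by simp
  then obtain r where r: "0 < r" "cnj (D $$ (Suc 0, 0)) = of_real r" using complex_pos_iff by blast
  then have D1: "D $$ (Suc 0, 0) = of_real r" by (metis complex_cnj_cnj complex_cnj_complex_of_real)
  \<comment> \<open>The choice is forced: the corner entry of \<Xi>(w) is the conjugate of
    w.\<close>
  define w where "w = cnj (D $$ (0, 0))"
  have "1 = (mat_adjoint D * D) $$ (0, 0)" using D by (simp add: unitary_group_def)
  also have "\<dots> = (\<Sum>t<?n. mat_adjoint D $$ (0, t) * D $$ (t, 0))"
    by (intro index_mult_mat_sum[OF mat_adjoint_carrier[OF Dc] Dc]) simp_all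
  also have "\<dots> = w * cnj w + of_real r * of_real r"
    by (simp add: sum.lessThan_Suc_shift index_mat_adjoint[OF Dc] D0 D1 w_def del: sum.lessThan_Suc)
  also have "\<dots> = of_real ((cmod w)\<^sup>2 + r\<^sup>2)"
    by (simp add: complex_norm_square[symmetric] power2_eq_square)
  finally have wr: "(cmod w)\<^sup>2 + r\<^sup>2 = 1" by (metis of_real_1 of_real_eq_iff)
  have rw: "sqrt (1 - (cmod w)\<^sup>2) = r" using wr r(1) by (intro real_sqrt_unique) simp_all
  have w1: "cmod w < 1"
  proof -
    have "(cmod w)\<^sup>2 < 1\<^sup>2" using wr r(1) by (smt (verit) zero_less_power one_power2)
    then show ?thesis by (rule power_less_imp_less_base) simp
  qed
  define V where "V = mat_sum (cmv_block w) (1\<^sub>m m)"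
  have V: "V \<in> carrier (unitary_group ?n)"
    unfolding V_def using cmv_step_GL(1)[OF _ unitary_GL(1)[OF X], of w] w1 by simp
  have Vc: "V \<in> carrier_mat ?n ?n" using V by (simp add: unitary_iff)
  have VD: "V $$ (i, 0) = D $$ (i, 0)" if "i < ?n" for i
  proof -
    consider "i = 0" | "i = Suc 0" | j where "i = Suc (Suc j)" by (metis not0_implies_Suc)
    then show ?thesis
      using that by cases (simp_all add: V_def cmv_block_sum_first_column D0 D1 rw, simp add: w_def)
  qed
  \<comment> \<open>Since \<open>V\<close> and \<open>D\<close> have the same first column, the
    first column of \<open>M\<close> is that of the adjoint of \<open>V\<close> times
    \<open>V\<close>, the first basis vector.\<close>
  define M where "M = mat_adjoint V * D"
  have M: "M \<in> carrier (unitary_group ?n)"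
    unfolding M_def using unitary_closed[OF V V] D unitary_closed(1) unitary_GL(2)[OF V] by metis
  have "M $$ (i, 0) = (if i = 0 then 1 else 0)" if i: "i < ?n" for i
  proof -
    have "M $$ (i, 0) = (\<Sum>t<?n. mat_adjoint V $$ (i, t) * D $$ (t, 0))"
      unfolding M_def using i by (intro index_mult_mat_sum[OF mat_adjoint_carrier[OF Vc] Dc]) simp_all
    also have "\<dots> = (\<Sum>t<?n. mat_adjoint V $$ (i, t) * V $$ (t, 0))"
      by (intro sum.cong refl) (simp add: VD)
    also have "\<dots> = (mat_adjoint V * V) $$ (i, 0)"
      using i by (intro index_mult_mat_sum[OF mat_adjoint_carrier[OF Vc] Vc, symmetric]) simp_all
    also have "\<dots> = (if i = 0 then 1 else 0)" using V i by (simp add: unitary_group_def)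
    finally show ?thesis .
  qed
  then have MY: "M = mat_sum (1\<^sub>m 1) (lower_right M)"
    by (intro unitary_first_column[OF M]) simp_all
  have Mc: "M \<in> carrier_mat ?n ?n" using M by (simp add: unitary_iff)
  show thesis
  proof (rule that)
    show "cmod w < 1" by (fact w1)
    show "lower_right M \<in> carrier (unitary_group (Suc m))"
      using M MY unitary_mat_sum_one_iff[OF lower_right_carrier[OF Mc]] by simp
    have "V * M = (V * mat_adjoint V) * D"
      unfolding M_def by (rule assoc_mult_mat[OF Vc mat_adjoint_carrier[OF Vc] Dc, symmetric])
    also have "\<dots> = D" using V left_mult_one_mat[OF Dc] by (simp add: unitary_iff)
    finally show "D = cmv_step m w (lower_right M)"
      unfolding cmv_step_def V_def[symmetric] MY[symmetric] ..
  qed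
qed

text \<open>Peel one block off \<open>D\<close>, cancel the blocks to see that the remainder is
  equivalent to a transposed CMV matrix, and transpose to reach the induction hypothesis. The
  coefficient of the new block is prepended to those obtained there. A unitary matrix of size 1 is a
  number of modulus 1, so it is CMV.\<close>

lemma unitary_equiv_cmv_matrix:
  assumes "cmv_coeffs m a" "D \<in> carrier (unitary_group (Suc m))"
    "lower_equiv (Suc m) (cmv_matrix (Suc m) a) D"
  shows "\<exists>b. cmv_coeffs m b \<and> D = cmv_matrix (Suc m) b"
  using assms
proof (induction m arbitrary: a D)
  case 0
  have Dc: "D \<in> carrier_mat 1 1" using 0 by (simp add: unitary_iff)
  have "1 = (D * mat_adjoint D) $$ (0, 0)" using 0 by (simp add: unitary_iff)
  also have "\<dots> = D $$ (0, 0) * cnj (D $$ (0, 0))"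
    using index_mult_mat_sum[OF Dc mat_adjoint_carrier[OF Dc], of 0 0] by (simp add: index_mat_adjoint[OF Dc])
  also have "\<dots> = of_real ((cmod (D $$ (0, 0)))\<^sup>2)" by (rule complex_norm_square[symmetric])
  finally have "(cmod (D $$ (0, 0)))\<^sup>2 = 1" by (metis of_real_1 of_real_eq_iff)
  then have "cmod (D $$ (0, 0)) = 1" by (simp add: abs_square_eq_1)
  moreover have "D = cmv_matrix (Suc 0) (\<lambda>_. cnj (D $$ (0, 0)))"
    unfolding cmv_matrix_1 using carrier_matD[OF Dc] by (intro eq_matI) simp_all
  ultimately show ?case by (intro exI[of _ "\<lambda>_. cnj (D $$ (0, 0))"]) (simp add: cmv_coeffs_def)
next
  case (Suc m)
  define A where "A = cmv_matrix (Suc m) (a \<circ> Suc)"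
  have a: "cmod (a 0) < 1" "cmv_coeffs m (a \<circ> Suc)" using Suc.prems(1) by (simp_all add: cmv_coeffs_Suc)
  have A: "A \<in> carrier (unitary_group (Suc m))" unfolding A_def using a(2) by (rule cmv_matrix_unitary)
  note At = unitary_transpose[OF A]
  have eq: "lower_equiv (Suc (Suc m)) (cmv_step m (a 0) (transpose_mat A)) D"
    using Suc.prems(3) by (simp add: cmv_matrix_Suc_Suc A_def)
  obtain w Y where w: "cmod w < 1" and Y: "Y \<in> carrier (unitary_group (Suc m))" and D: "D = cmv_step m w Y"
    using unitary_equiv_cmv_step[OF a(1) At Suc.prems(2) eq] .
  have "lower_equiv (Suc m) (transpose_mat A) Y"
    using eq cmv_step_equiv_iff[OF a(1) w unitary_GL(1)[OF At] unitary_GL(1)[OF Y]] by (simp add: D)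
  then have "lower_equiv (Suc m) A (transpose_mat Y)"
    using lower_equiv_transpose[OF _ At Y] by simp
  then obtain b where b: "cmv_coeffs m b" "transpose_mat Y = cmv_matrix (Suc m) b"
    using Suc.IH[OF a(2) unitary_transpose[OF Y]] unfolding A_def by blast
  define c where "c = case_nat w b"
  have c: "c 0 = w" "c \<circ> Suc = b" by (auto simp: c_def)
  have "D = cmv_matrix (Suc (Suc m)) c"
    unfolding cmv_matrix_Suc_Suc c by (simp add: D flip: b(2))
  moreover have "cmv_coeffs (Suc m) c" using w b(1) c by (simp add: cmv_coeffs_Suc)
  ultimately show ?case by blast
qed

section \<open>Dressing orbits\<close>

text \<open>If the dressing argument is \<open>p\<close> times the inverse of \<open>m\<close>, then
  \<open>p\<close> is the argument times \<open>m\<close>. Substituting this into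
  \<open>l * b * p\<close> cancels \<open>l\<close> and one \<open>b\<close>, which gives the second
  expression.\<close>

lemma dressing_eq:
  assumes b: "b \<in> carrier (GL n)" and l: "l \<in> carrier (lower_group n)" and w: "w \<in> carrier (unitary_group n)"
  obtains p m where "p \<in> carrier (lower_group n)" "m \<in> carrier (unitary_group n)"
    "dressing n (l, w) b = l * b * p" "dressing n (l, w) b = inv\<^bsub>GL n\<^esub> w * b * m"
    "m = minus_part n (dressing_arg n l w b)"
proof -
  note G = b lower_GL[OF l] unitary_GL(1)[OF w]
  have arg: "dressing_arg n l w b \<in> carrier (GL n)" unfolding dressing_arg_def using G by simp
  obtain p m where pm: "p \<in> carrier (lower_group n)" "m \<in> carrier (unitary_group n)"
    and eq: "dressing_arg n l w b = p * inv\<^bsub>GL n\<^esub> m"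
    using lower_unitary_factorization[OF arg] .
  note H = lower_GL[OF pm(1)] unitary_GL(1)[OF pm(2)]
  have d: "dressing n (l, w) b = l * b * p"
    by (simp add: dressing_def eq plus_minus_part_eq[OF pm])
  have "l * b * p = l * b * (p * inv\<^bsub>GL n\<^esub> m) * m"
    using G H by (simp add: GL_assoc[where n = n])
  also have "\<dots> = (l * (b * inv\<^bsub>GL n\<^esub> b) * inv\<^bsub>GL n\<^esub> l) * inv\<^bsub>GL n\<^esub> w * b * m"
    unfolding eq[symmetric] dressing_arg_def using G H by (simp add: GL_assoc[where n = n] del: GL_simps(5,6))
  also have "\<dots> = inv\<^bsub>GL n\<^esub> w * b * m" using G H by simp
  finally have d': "dressing n (l, w) b = inv\<^bsub>GL n\<^esub> w * b * m" unfolding d .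
  have "m = minus_part n (dressing_arg n l w b)" unfolding eq plus_minus_part_eq(2)[OF pm] ..
  with pm d d' show thesis by (rule that)
qed

text \<open>One expression for the dressed matrix exhibits triangular equivalence, the other
  unitarity; the converse needs a suitable unitary group element.\<close>

lemma unitary_orbit:
  assumes C: "C \<in> carrier (unitary_group n)"
  shows "orbit (dressing_group n) (dressing n) C = {D \<in> carrier (unitary_group n). lower_equiv n C D}"
proof (intro equalityI subsetI)
  have G: "(l, w) \<in> carrier (dressing_group n) \<longleftrightarrow> l \<in> carrier (lower_group n) \<and> w \<in> carrier (unitary_group n)" for l w
    by (simp add: dressing_group_def DirProd_def reversed_def)
  note CG = unitary_GL(1)[OF C]
  {
    fix D assume "D \<in> orbit (dressing_group n) (dressing n) C"
    then obtain l w where lw: "l \<in> carrier (lower_group n)" "w \<in> carrier (unitary_group n)"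
      and D: "D = dressing n (l, w) C"
      using G by (auto simp: orbit_def)
    obtain p m where pm: "p \<in> carrier (lower_group n)" "m \<in> carrier (unitary_group n)"
      "D = l * C * p" "D = inv\<^bsub>GL n\<^esub> w * C * m"
      using dressing_eq[OF CG lw] D by metis
    have "inv\<^bsub>GL n\<^esub> w * C * m \<in> carrier (unitary_group n)"
      using pm(2) lw(2) C by (intro unitary_closed)
    then show "D \<in> {D \<in> carrier (unitary_group n). lower_equiv n C D}"
      using lower_equivI[OF lw(1) pm(1,3)] pm(4) by simp
  next
    fix D assume "D \<in> {D \<in> carrier (unitary_group n). lower_equiv n C D}"
    then obtain l p where D: "D \<in> carrier (unitary_group n)" and l: "l \<in> carrier (lower_group n)"
      and p: "p \<in> carrier (lower_group n)" and eq: "D = l * C * p"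
      by (auto elim: lower_equivE)
    \<comment> \<open>Chosen so that the inverse of \<open>w\<close> times \<open>C\<close> is
      \<open>D\<close>. The dressing argument then collapses to \<open>p\<close>, whose plus part is
      \<open>p\<close> and whose minus part is the identity.\<close>
    define w where "w = C * inv\<^bsub>GL n\<^esub> D"
    have w: "w \<in> carrier (unitary_group n)" unfolding w_def using C D by (intro unitary_closed)
    have one: "1\<^sub>m n \<in> carrier (unitary_group n)"
      using subgroup.one_closed[OF unitary_subgroup, of n] by (simp add: one_GL)
    note H = CG unitary_GL(1)[OF D] lower_GL[OF l] lower_GL[OF p] unitary_GL(1)[OF one]
    have inv1: "inv\<^bsub>GL n\<^esub> (1\<^sub>m n) = 1\<^sub>m n"
      by (rule right_inverse_GL(2)) simp_all
    have "dressing_arg n l w C = inv\<^bsub>GL n\<^esub> C * inv\<^bsub>GL n\<^esub> l * (D * inv\<^bsub>GL n\<^esub> C) * C"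
      unfolding dressing_arg_def w_def using H by (simp add: GL_inv_mult[where n = n])
    also have "\<dots> = inv\<^bsub>GL n\<^esub> C * inv\<^bsub>GL n\<^esub> l * D"
      using H by (simp add: GL_assoc[where n = n])
    also have "\<dots> = p"
      unfolding eq using H(1,3,4) by (simp flip: GL_assoc[where n = n])
        (simp add: GL_assoc[of _ n "inv\<^bsub>GL n\<^esub> l" l])
    also have "\<dots> = p * inv\<^bsub>GL n\<^esub> (1\<^sub>m n)" using H by (simp add: inv1)
    finally have "dressing n (l, w) C = D"
      by (simp add: dressing_def plus_minus_part_eq[OF p one] eq)
    then show "D \<in> orbit (dressing_group n) (dressing n) C"
      using G l w unfolding orbit_def by fastforce
  }
qed

text \<open>Since \<open>dressing\<close> is defined through the plus part alone, its agreement with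
  the expression in the minus part belongs to the claim.\<close>

theorem theorem4p7:
  fixes n :: nat and C :: "complex mat"
  assumes "0 < n" and "C \<in> cmv_matrices n"
  shows "(\<forall>b \<in> carrier (GL n). \<forall>l \<in> carrier (lower_group n). \<forall>w \<in> carrier (unitary_group n).
            dressing n (l, w) b = inv\<^bsub>GL n\<^esub> w * b * minus_part n (dressing_arg n l w b)) \<and>
         orbit (dressing_group n) (dressing n) C = {C' \<in> cmv_matrices n. det C' = det C}"
proof (intro conjI ballI)
  fix b l w assume "b \<in> carrier (GL n)" "l \<in> carrier (lower_group n)" "w \<in> carrier (unitary_group n)"
  then show "dressing n (l, w) b = inv\<^bsub>GL n\<^esub> w * b * minus_part n (dressing_arg n l w b)"
    by (rule dressing_eq) simp
next
  obtain m where n: "n = Suc m" using assms(1) by (cases n) auto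
  obtain a where a: "cmv_coeffs m a" and C: "C = cmv_matrix (Suc m) a"
    using assms(2) by (auto simp: n cmv_matrices_Suc)
  have CU: "C \<in> carrier (unitary_group n)" using cmv_matrix_unitary[OF a] by (simp add: C n)
  \<comment> \<open>With the orbit described by unitarity and triangular equivalence, the
    determinant condition is the invariance of \<open>det\<close> in one direction and the
    hypothesis for the equivalence of CMV matrices in the other.\<close>
  have "D \<in> carrier (unitary_group n) \<and> lower_equiv n C D \<longleftrightarrow> D \<in> cmv_matrices n \<and> det D = det C" for D
  proof
    assume D: "D \<in> carrier (unitary_group n) \<and> lower_equiv n C D"
    then have "D \<in> cmv_matrices n"
      using unitary_equiv_cmv_matrix[OF a, of D] by (auto simp: n C cmv_matrices_Suc)
    with D show "D \<in> cmv_matrices n \<and> det D = det C" using lower_equiv_det[OF _ CU, of D] by simp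
  next
    assume D: "D \<in> cmv_matrices n \<and> det D = det C"
    then obtain b where b: "cmv_coeffs m b" "D = cmv_matrix (Suc m) b" by (auto simp: n cmv_matrices_Suc)
    then show "D \<in> carrier (unitary_group n) \<and> lower_equiv n C D"
      using D cmv_matrix_unitary[OF b(1)] cmv_matrix_equiv[OF a b(1)] by (simp add: n C)
  qed
  then show "orbit (dressing_group n) (dressing n) C = {C' \<in> cmv_matrices n. det C' = det C}"
    unfolding unitary_orbit[OF CU] by simp
qed

end
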